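(* Let $A$ be a ring that is either a Noetherian local ring or a standard graded ring, let $I\subset A$ be an ideal, and let $M$ be a non-zero $A$-module with $\operatorname{Supp}(M)\subset V(I)$ (in the graded case, $M$ is graded and ideals and elements are homogeneous). A sequence $x_1,\ldots,x_r$ ($r\ge 1$) of elements of $I$ is coregular for $M$ if and only if the Koszul cohomology groups $H^i(x_1,\ldots,x_r;M)$ are zero for all $i\ge 1$.
   Context: A standard graded ring means a Noetherian graded ring generated by its degree-one elements over a field $A_0$; in the graded case all modules are graded and all ideals and elements are homogeneous. Coregular sequence: let $I$ be an ideal of $A$ and $M$ a non-zero $A$-module with $\operatorname{Supp}(M)\subset V(I)$. A sequence $x_1,\ldots,x_r$ of elements of $I$ is coregular for $M$ if $x_1M=M$ and, for each $1\le i\le r-1$, $x_{i+1}\,(0:_M(x_1,\ldots,x_i))=0:_M(x_1,\ldots,x_i)$. $H^i(x_1,\ldots,x_r;M)$ is the $i$-th cohomology of the Koszul cochain complex $K^\bullet(x_1,\ldots,x_r;M)=\operatorname{Hom}_A(K_\bullet(x_1,\ldots,x_r),M)$, so $H^0(x_1,\ldots,x_r;M)=0:_M(x_1,\ldots,x_r)$ and $H^r(x_1,\ldots,x_r;M)=M/(x_1,\ldots,x_r)M$. *)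

theory Defs
  imports "HOL-Algebra.Algebra"
begin

section \<open>Noetherian local rings\<close>

definition noetherian_local_ring :: "('a, 'c) ring_scheme \<Rightarrow> bool" where
  "noetherian_local_ring A \<longleftrightarrow>
     cring A \<and> noetherian_ring A \<and> (\<exists>!\<mm>. maximalideal \<mm> A)"


section \<open>Gradings\<close>

text \<open>
  The additive group of \<open>G\<close> is the internal direct sum of the subgroups \<open>\<G> i\<close>. Since module
  records extend ring records, this serves both for rings and for modules.
\<close>
definition direct_sum_decomposition :: "('m, 'd) ring_scheme \<Rightarrow> ('i \<Rightarrow> 'm set) \<Rightarrow> bool" where
  "direct_sum_decomposition G \<G> \<longleftrightarrow>
     (\<forall>i. subgroup (\<G> i) (add_monoid G)) \<and>
     (\<forall>x \<in> carrier G. \<exists>!c. (\<forall>i. c i \<in> \<G> i) \<and> finite {i. c i \<noteq> \<zero>\<^bsub>G\<^esub>} \<and>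
        x = (\<Oplus>\<^bsub>G\<^esub> i \<in> {i. c i \<noteq> \<zero>\<^bsub>G\<^esub>}. c i))"

definition graded_ring :: "('a, 'c) ring_scheme \<Rightarrow> (nat \<Rightarrow> 'a set) \<Rightarrow> bool" where
  "graded_ring A \<A> \<longleftrightarrow>
     cring A \<and> direct_sum_decomposition A \<A> \<and>
     (\<forall>i j. \<forall>a \<in> \<A> i. \<forall>b \<in> \<A> j. a \<otimes>\<^bsub>A\<^esub> b \<in> \<A> (i + j))"

definition standard_graded_ring :: "('a, 'c) ring_scheme \<Rightarrow> (nat \<Rightarrow> 'a set) \<Rightarrow> bool" where
  "standard_graded_ring A \<A> \<longleftrightarrow>
     graded_ring A \<A> \<and> noetherian_ring A \<and> subfield (\<A> 0) A \<and>
     generate_ring A (\<A> 0 \<union> \<A> 1) = carrier A"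

text \<open>Modules over an \<open>\<nat>\<close>-graded ring are graded by the integers.\<close>
definition graded_module ::
    "('a, 'c) ring_scheme \<Rightarrow> (nat \<Rightarrow> 'a set) \<Rightarrow> ('a, 'm, 'd) module_scheme \<Rightarrow> (int \<Rightarrow> 'm set) \<Rightarrow> bool" where
  "graded_module A \<A> M \<M> \<longleftrightarrow>
     module A M \<and> direct_sum_decomposition M \<M> \<and>
     (\<forall>i j. \<forall>a \<in> \<A> i. \<forall>m \<in> \<M> j. a \<odot>\<^bsub>M\<^esub> m \<in> \<M> (int i + j))"

definition homogeneous_elements :: "(nat \<Rightarrow> 'a set) \<Rightarrow> 'a set" where
  "homogeneous_elements \<A> = (\<Union>n. \<A> n)"

definition homogeneous_ideal :: "('a, 'c) ring_scheme \<Rightarrow> (nat \<Rightarrow> 'a set) \<Rightarrow> 'a set \<Rightarrow> bool" where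
  "homogeneous_ideal A \<A> I \<longleftrightarrow>
     ideal I A \<and> I = Idl\<^bsub>A\<^esub> (I \<inter> homogeneous_elements \<A>)"


section \<open>Localization at a prime and support\<close>

text \<open>
  The fractions \<open>m / s\<close> with \<open>s \<notin> P\<close>, as equivalence classes of pairs \<open>(m, s)\<close>. The localization
  is given as an \<open>A\<close>-module. The fields \<open>mult\<close> and \<open>one\<close>, which module records inherit from ring
  records, carry no meaning for a module, here and below.
\<close>
definition fraction_rel ::
    "('a, 'c) ring_scheme \<Rightarrow> ('a, 'm, 'd) module_scheme \<Rightarrow> 'a set \<Rightarrow> (('m \<times> 'a) \<times> ('m \<times> 'a)) set" where
  "fraction_rel A M P =
     {((m, s), (n, t)) | m s n t.
        m \<in> carrier M \<and> n \<in> carrier M \<and> s \<in> carrier A - P \<and> t \<in> carrier A - P \<and>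
        (\<exists>u \<in> carrier A - P. u \<odot>\<^bsub>M\<^esub> (t \<odot>\<^bsub>M\<^esub> m) = u \<odot>\<^bsub>M\<^esub> (s \<odot>\<^bsub>M\<^esub> n))}"

definition localized_module ::
    "('a, 'c) ring_scheme \<Rightarrow> ('a, 'm, 'd) module_scheme \<Rightarrow> 'a set \<Rightarrow> ('a, ('m \<times> 'a) set) module" where
  "localized_module A M P =
     \<lparr>carrier = (carrier M \<times> (carrier A - P)) // fraction_rel A M P,
      monoid.mult = undefined,
      one = undefined,
      ring.zero = fraction_rel A M P `` {(\<zero>\<^bsub>M\<^esub>, \<one>\<^bsub>A\<^esub>)},
      add = (\<lambda>C D. \<Union>(m, s) \<in> C. \<Union>(n, t) \<in> D.
               fraction_rel A M P `` {(t \<odot>\<^bsub>M\<^esub> m \<oplus>\<^bsub>M\<^esub> s \<odot>\<^bsub>M\<^esub> n, s \<otimes>\<^bsub>A\<^esub> t)}),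
      smult = (\<lambda>a C. \<Union>(m, s) \<in> C. fraction_rel A M P `` {(a \<odot>\<^bsub>M\<^esub> m, s)})\<rparr>"

definition Supp :: "('a, 'c) ring_scheme \<Rightarrow> ('a, 'm, 'd) module_scheme \<Rightarrow> 'a set set" where
  "Supp A M = {P. primeideal P A \<and>
     carrier (localized_module A M P) \<noteq> {\<zero>\<^bsub>localized_module A M P\<^esub>}}"

definition zero_locus :: "('a, 'c) ring_scheme \<Rightarrow> 'a set \<Rightarrow> 'a set set" where
  "zero_locus A I = {P. primeideal P A \<and> I \<subseteq> P}"


section \<open>Coregular sequences\<close>

text \<open>The submodule \<open>0 :\<^sub>M J\<close>.\<close>
definition zero_colon :: "('a, 'm, 'd) module_scheme \<Rightarrow> 'a set \<Rightarrow> 'm set" where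
  "zero_colon M J = {m \<in> carrier M. \<forall>a \<in> J. a \<odot>\<^bsub>M\<^esub> m = \<zero>\<^bsub>M\<^esub>}"

text \<open>
  A sequence \<open>x\<^sub>1, \<dots>, x\<^sub>r\<close> is the list \<open>xs\<close>, so that \<open>x\<^bsub>i+1\<^esub>\<close> is \<open>xs ! i\<close>. The standing assumptions
  on \<open>M\<close> and on the ideal containing the sequence are not part of this predicate.
\<close>
definition coregular ::
    "('a, 'c) ring_scheme \<Rightarrow> ('a, 'm, 'd) module_scheme \<Rightarrow> 'a list \<Rightarrow> bool" where
  "coregular A M xs \<longleftrightarrow>
     (\<lambda>m. xs ! 0 \<odot>\<^bsub>M\<^esub> m) ` carrier M = carrier M \<and>
     (\<forall>i. 1 \<le> i \<and> i \<le> length xs - 1 \<longrightarrow>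
        (\<lambda>m. xs ! i \<odot>\<^bsub>M\<^esub> m) ` zero_colon M (Idl\<^bsub>A\<^esub> (set (take i xs)))
          = zero_colon M (Idl\<^bsub>A\<^esub> (set (take i xs))))"


section \<open>The Koszul complex\<close>

definition koszul_index :: "nat \<Rightarrow> nat \<Rightarrow> nat set set" where
  "koszul_index r p = {S. S \<subseteq> {..<r} \<and> card S = p}"

text \<open>
  \<open>K\<^sub>p\<close> is the free module with basis \<open>e\<^sub>S\<close>, for \<open>S\<close> a \<open>p\<close>-element subset of \<open>{0, \<dots>, r - 1}\<close>; it is
  the \<open>p\<close>-th exterior power of \<open>A\<^sup>r\<close>. An element is the family of its coefficients.
\<close>
definition koszul_chains :: "('a, 'c) ring_scheme \<Rightarrow> nat \<Rightarrow> nat \<Rightarrow> ('a, nat set \<Rightarrow> 'a) module" where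
  "koszul_chains A r p =
     \<lparr>carrier = koszul_index r p \<rightarrow>\<^sub>E carrier A,
      monoid.mult = undefined,
      one = undefined,
      ring.zero = (\<lambda>S \<in> koszul_index r p. \<zero>\<^bsub>A\<^esub>),
      add = (\<lambda>c d. \<lambda>S \<in> koszul_index r p. c S \<oplus>\<^bsub>A\<^esub> d S),
      smult = (\<lambda>a c. \<lambda>S \<in> koszul_index r p. a \<otimes>\<^bsub>A\<^esub> c S)\<rparr>"

text \<open>
  The differential \<open>K\<^bsub>p+1\<^esub> \<rightarrow> K\<^sub>p\<close> maps \<open>e\<^sub>S\<close> to the sum over \<open>j \<in> S\<close> of \<open>(-1)\<^sup>k x\<^sub>j e\<^bsub>S - {j}\<^esub>\<close>, where \<open>k\<close>
  is the number of elements of \<open>S\<close> below \<open>j\<close>. Below is the coefficient of the image at \<open>e\<^sub>T\<close>, to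
  which the basis vectors \<open>e\<^bsub>T \<union> {j}\<^esub>\<close> with \<open>j \<notin> T\<close> contribute.
\<close>
definition koszul_diff ::
    "('a, 'c) ring_scheme \<Rightarrow> 'a list \<Rightarrow> nat \<Rightarrow> (nat set \<Rightarrow> 'a) \<Rightarrow> (nat set \<Rightarrow> 'a)" where
  "koszul_diff A xs p c =
     (\<lambda>T \<in> koszul_index (length xs) p.
        \<Oplus>\<^bsub>A\<^esub> j \<in> {..<length xs} - T.
          ((\<ominus>\<^bsub>A\<^esub> \<one>\<^bsub>A\<^esub>) [^]\<^bsub>A\<^esub> card {i \<in> T. i < j}) \<otimes>\<^bsub>A\<^esub> (xs ! j) \<otimes>\<^bsub>A\<^esub> c (insert j T))"

definition hom_module ::
    "('a, 'c) ring_scheme \<Rightarrow> ('a, 'n, 'e) module_scheme \<Rightarrow> ('a, 'm, 'd) module_scheme \<Rightarrow>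
     ('a, 'n \<Rightarrow> 'm) module" where
  "hom_module A N M =
     \<lparr>carrier = {f \<in> carrier N \<rightarrow>\<^sub>E carrier M.
         (\<forall>x \<in> carrier N. \<forall>y \<in> carrier N. f (x \<oplus>\<^bsub>N\<^esub> y) = f x \<oplus>\<^bsub>M\<^esub> f y) \<and>
         (\<forall>a \<in> carrier A. \<forall>x \<in> carrier N. f (a \<odot>\<^bsub>N\<^esub> x) = a \<odot>\<^bsub>M\<^esub> f x)},
      monoid.mult = undefined,
      one = undefined,
      ring.zero = (\<lambda>x \<in> carrier N. \<zero>\<^bsub>M\<^esub>),
      add = (\<lambda>f g. \<lambda>x \<in> carrier N. f x \<oplus>\<^bsub>M\<^esub> g x),
      smult = (\<lambda>a f. \<lambda>x \<in> carrier N. a \<odot>\<^bsub>M\<^esub> f x)\<rparr>"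

definition koszul_cochains ::
    "('a, 'c) ring_scheme \<Rightarrow> nat \<Rightarrow> ('a, 'm, 'd) module_scheme \<Rightarrow> nat \<Rightarrow>
     ('a, (nat set \<Rightarrow> 'a) \<Rightarrow> 'm) module" where
  "koszul_cochains A r M p = hom_module A (koszul_chains A r p) M"

definition koszul_codiff ::
    "('a, 'c) ring_scheme \<Rightarrow> 'a list \<Rightarrow> nat \<Rightarrow> ((nat set \<Rightarrow> 'a) \<Rightarrow> 'm) \<Rightarrow> ((nat set \<Rightarrow> 'a) \<Rightarrow> 'm)" where
  "koszul_codiff A xs p f =
     (\<lambda>c \<in> carrier (koszul_chains A (length xs) (Suc p)). f (koszul_diff A xs p c))"

definition koszul_cocycles ::
    "('a, 'c) ring_scheme \<Rightarrow> 'a list \<Rightarrow> ('a, 'm, 'd) module_scheme \<Rightarrow> nat \<Rightarrow>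
     ((nat set \<Rightarrow> 'a) \<Rightarrow> 'm) set" where
  "koszul_cocycles A xs M p =
     {f \<in> carrier (koszul_cochains A (length xs) M p).
        koszul_codiff A xs p f = \<zero>\<^bsub>koszul_cochains A (length xs) M (Suc p)\<^esub>}"

definition koszul_coboundaries ::
    "('a, 'c) ring_scheme \<Rightarrow> 'a list \<Rightarrow> ('a, 'm, 'd) module_scheme \<Rightarrow> nat \<Rightarrow>
     ((nat set \<Rightarrow> 'a) \<Rightarrow> 'm) set" where
  "koszul_coboundaries A xs M p =
     (case p of
        0 \<Rightarrow> {\<zero>\<^bsub>koszul_cochains A (length xs) M 0\<^esub>}
      | Suc q \<Rightarrow> koszul_codiff A xs q ` carrier (koszul_cochains A (length xs) M q))"

definition koszul_cohomology ::
    "('a, 'c) ring_scheme \<Rightarrow> 'a list \<Rightarrow> ('a, 'm, 'd) module_scheme \<Rightarrow> nat \<Rightarrow>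
     ((nat set \<Rightarrow> 'a) \<Rightarrow> 'm) set monoid" where
  "koszul_cohomology A xs M p =
     add_monoid (koszul_cochains A (length xs) M p \<lparr>carrier := koszul_cocycles A xs M p\<rparr>)
       Mod koszul_coboundaries A xs M p"

end

theory Submission
  imports Defs
begin

text \<open>
  Since \<open>A\<close> is commutative and \<open>Supp(M) \<subseteq> V(I)\<close>, every element of \<open>M\<close> is killed by a power of each
  \<open>x \<in> I\<close>. The Koszul complex of \<open>x\<^sub>1, \<dots>, x\<^bsub>r+1\<^esub>\<close> is the mapping cone of multiplication by \<open>x\<^bsub>r+1\<^esub>\<close> on
  that of \<open>x\<^sub>1, \<dots>, x\<^sub>r\<close>, so vanishing of its cohomology in all degrees \<open>\<ge> 1\<close> means that \<open>x\<^bsub>r+1\<^esub>\<close> acts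
  surjectively on each \<open>H\<^sup>i(x\<^sub>1, \<dots>, x\<^sub>r; M)\<close> with \<open>i \<ge> 0\<close> and injectively on those with \<open>i \<ge> 1\<close>. An
  injective endomorphism under which every element has a vanishing iterate lives on the zero module,
  hence the latter groups vanish, and what remains is surjectivity on
  \<open>H\<^sup>0(x\<^sub>1, \<dots>, x\<^sub>r; M) = 0 :\<^sub>M (x\<^sub>1, \<dots>, x\<^sub>r)\<close>. Induction on \<open>r\<close> gives both directions.
\<close>

section \<open>Torsion and support\<close>

text \<open>An ideal maximal among those containing \<open>J\<close> and missing every power of
  \<open>x\<close> is prime; Zorn applies because the union of a chain of such ideals is again one.
  If \<open>a\<close> and \<open>b\<close> lay outside \<open>P\<close>, then \<open>P + (a)\<close>
  and \<open>P + (b)\<close> would each contain a power of \<open>x\<close>, and the product of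
  these powers would lie in \<open>P + (ab)\<close>, hence in \<open>P\<close> as soon as
  \<open>ab\<close> does.\<close>

lemma (in cring) exists_primeideal_avoiding_powers:
  assumes J: "ideal J R" and x: "x \<in> carrier R" and avoid: "\<And>n::nat. x [^] n \<notin> J"
  obtains P where "primeideal P R" "J \<subseteq> P" "x \<notin> P"
proof -
  define \<F> where "\<F> = {K. ideal K R \<and> J \<subseteq> K \<and> (\<forall>n::nat. x [^] n \<notin> K)}"
  have "\<exists>P \<in> \<F>. \<forall>K \<in> \<F>. P \<subseteq> K \<longrightarrow> K = P"
  proof (rule subset_Zorn_nonempty)
    show "\<F> \<noteq> {}"
      using J avoid by (auto simp: \<F>_def)
    fix \<C> assume \<C>: "\<C> \<noteq> {}" "subset.chain \<F> \<C>"
    then have "subset.chain {K. ideal K R} \<C>"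
      by (auto simp: pred_on.chain_def \<F>_def)
    then have "ideal (\<Union>\<C>) R"
      using chain_Union_is_ideal[of \<C>] \<C>(1) by simp
    moreover have "\<C> \<subseteq> \<F>"
      using \<C>(2) by (simp add: pred_on.chain_def)
    ultimately show "\<Union>\<C> \<in> \<F>"
      using \<C>(1) by (auto simp: \<F>_def)
  qed
  then obtain P where "P \<in> \<F>" and maximal_in: "\<And>K. K \<in> \<F> \<Longrightarrow> P \<subseteq> K \<Longrightarrow> K = P"
    by blast
  then have P: "ideal P R" "J \<subseteq> P" "\<And>n::nat. x [^] n \<notin> P"
    by (simp_all add: \<F>_def)
  have maximal: "\<exists>n::nat. x [^] n \<in> K" if "ideal K R" "P \<subseteq> K" "K \<noteq> P" for K
    using maximal_in[of K] that P(2) by (auto simp: \<F>_def)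
  interpret P: ideal P R by fact
  have power_mem: "\<exists>(n::nat) p c. p \<in> P \<and> c \<in> carrier R \<and> x [^] n = p \<oplus> c \<otimes> a"
    if a: "a \<in> carrier R" "a \<notin> P" for a
  proof -
    have "ideal (P <+> PIdl a) R"
      using P(1) a by (intro add_ideals cgenideal_ideal)
    moreover have "P \<subseteq> P <+> PIdl a"
    proof
      fix p assume "p \<in> P"
      moreover have "\<zero> \<in> PIdl a"
        using a by (simp add: cgenideal_ideal additive_subgroup.zero_closed ideal.axioms)
      ultimately have "p \<oplus> \<zero> \<in> P <+> PIdl a"
        unfolding set_add_def' by blast
      then show "p \<in> P <+> PIdl a"
        using \<open>p \<in> P\<close> by simp
    qed
    moreover have "a \<in> P <+> PIdl a"
    proof -
      have "\<zero> \<oplus> a \<in> P <+> PIdl a"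
        unfolding set_add_def' using cgenideal_self a P.zero_closed by blast
      then show ?thesis
        using a by simp
    qed
    ultimately obtain n :: nat where "x [^] n \<in> P <+> PIdl a"
      using maximal a(2) by blast
    then show ?thesis
      unfolding set_add_def' cgenideal_def by blast
  qed
  have "primeideal P R"
  proof (rule primeidealI)
    \<comment> \<open>The exponent 0 gives \<open>\<one> \<notin> P\<close>.\<close>
    show "carrier R \<noteq> P"
      using P(3)[of 0] by auto
    fix a b assume ab: "a \<in> carrier R" "b \<in> carrier R" "a \<otimes> b \<in> P"
    show "a \<in> P \<or> b \<in> P"
    proof (rule ccontr)
      assume "\<not> (a \<in> P \<or> b \<in> P)"
      then obtain n k :: nat and p q c d where
        pc: "p \<in> P" "c \<in> carrier R" "x [^] n = p \<oplus> c \<otimes> a" and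
        qd: "q \<in> P" "d \<in> carrier R" "x [^] k = q \<oplus> d \<otimes> b"
        using power_mem ab by meson
      have carr: "p \<in> carrier R" "q \<in> carrier R"
        using pc qd by simp_all
      have "x [^] (n + k) = (p \<oplus> c \<otimes> a) \<otimes> (q \<oplus> d \<otimes> b)"
        using pc qd x by (simp add: nat_pow_mult[symmetric])
      \<comment> \<open>The three summands are grouped so that each has a factor in
        \<open>P\<close>: \<open>p\<close>, \<open>q\<close> and
        \<open>a \<otimes> b\<close>.\<close>
      also have "\<dots> = (p \<otimes> (q \<oplus> d \<otimes> b) \<oplus> (c \<otimes> a) \<otimes> q) \<oplus> (c \<otimes> d) \<otimes> (a \<otimes> b)"
        using carr pc qd ab by algebra
      also have "\<dots> \<in> P"
      proof -
        have "p \<otimes> (q \<oplus> d \<otimes> b) \<in> P" "(c \<otimes> a) \<otimes> q \<in> P" "(c \<otimes> d) \<otimes> (a \<otimes> b) \<in> P"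
          using carr pc qd ab by (simp_all add: P.I_l_closed P.I_r_closed del: m_assoc)
        then show ?thesis
          by (intro P.a_closed)
      qed
      finally show False
        using P(3) by blast
    qed
  qed (use P is_cring in auto)
  moreover have "x \<notin> P"
    using P(3)[of 1] x by simp
  ultimately show ?thesis
    using that P(2) by blast
qed

lemma (in module) annihilator_ideal:
  assumes m: "m \<in> carrier M"
  shows "ideal {a \<in> carrier R. a \<odot>\<^bsub>M\<^esub> m = \<zero>\<^bsub>M\<^esub>} R"
proof (rule idealI)
  show "subgroup {a \<in> carrier R. a \<odot>\<^bsub>M\<^esub> m = \<zero>\<^bsub>M\<^esub>} (add_monoid R)"
    using m by (intro R.add.subgroupI) (auto simp: smult_l_distr smult_l_minus)
  fix a b
  assume "a \<in> {a \<in> carrier R. a \<odot>\<^bsub>M\<^esub> m = \<zero>\<^bsub>M\<^esub>}" "b \<in> carrier R"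
  then show "b \<otimes> a \<in> {a \<in> carrier R. a \<odot>\<^bsub>M\<^esub> m = \<zero>\<^bsub>M\<^esub>}"
    and "a \<otimes> b \<in> {a \<in> carrier R. a \<odot>\<^bsub>M\<^esub> m = \<zero>\<^bsub>M\<^esub>}"
    using m by (simp_all add: R.m_comm[of a b] smult_assoc1)
qed (rule R.ring_axioms)

text \<open>The fraction \<open>m / 1\<close> is non-zero in the localization: it could vanish only
  if some \<open>u\<close> outside \<open>P\<close> killed \<open>m\<close>.\<close>

lemma (in module) mem_Supp:
  assumes P: "primeideal P R" and m: "m \<in> carrier M"
    and ann: "{a \<in> carrier R. a \<odot>\<^bsub>M\<^esub> m = \<zero>\<^bsub>M\<^esub>} \<subseteq> P"
  shows "P \<in> Supp R M"
proof -
  interpret P: primeideal P R by fact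
  have one: "\<one> \<in> carrier R - P"
    using P.I_notcarr P.one_imp_carrier by auto
  let ?C = "fraction_rel R M P `` {(m, \<one>)}"
  have "?C \<in> carrier (localized_module R M P)"
    using m one by (auto simp: localized_module_def quotient_def)
  moreover have "?C \<noteq> \<zero>\<^bsub>localized_module R M P\<^esub>"
  proof
    assume eq: "?C = \<zero>\<^bsub>localized_module R M P\<^esub>"
    \<comment> \<open>The class contains its own representative, so equality with the zero class
      relates \<open>(\<zero>, \<one>)\<close> to \<open>(m, \<one>)\<close>; the multiplier in
      \<open>fraction_rel\<close> then kills \<open>m\<close>.\<close>
    have "(m, \<one>) \<in> ?C"
      using m one by (auto simp: fraction_rel_def)
    then have "((\<zero>\<^bsub>M\<^esub>, \<one>), (m, \<one>)) \<in> fraction_rel R M P"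
      using eq by (simp add: localized_module_def)
    then obtain u where u: "u \<in> carrier R - P" "u \<odot>\<^bsub>M\<^esub> m = \<zero>\<^bsub>M\<^esub>"
      using m by (auto simp: fraction_rel_def)
    then show False
      using ann by blast
  qed
  ultimately show ?thesis
    using P by (auto simp: Supp_def)
qed

text \<open>Otherwise the annihilator of \<open>m\<close> would miss all powers of \<open>x\<close>
  and lie in a prime \<open>P\<close> without \<open>x\<close>. Such a \<open>P\<close> is in the
  support of \<open>M\<close>, hence contains \<open>I\<close> and with it \<open>x\<close>.\<close>

lemma (in module) power_torsion_of_Supp:
  assumes supp: "Supp R M \<subseteq> zero_locus R I" and x: "x \<in> I" "x \<in> carrier R" and m: "m \<in> carrier M"
  shows "\<exists>n::nat. (x [^] n) \<odot>\<^bsub>M\<^esub> m = \<zero>\<^bsub>M\<^esub>"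
proof (rule ccontr)
  assume "\<not> ?thesis"
  then obtain P where P: "primeideal P R" "{a \<in> carrier R. a \<odot>\<^bsub>M\<^esub> m = \<zero>\<^bsub>M\<^esub>} \<subseteq> P" "x \<notin> P"
    using R.exists_primeideal_avoiding_powers[OF annihilator_ideal[OF m] x(2)] by auto
  then have "P \<in> zero_locus R I"
    using mem_Supp m supp by blast
  then show False
    using P(3) x(1) by (auto simp: zero_locus_def)
qed

text \<open>The annihilator of \<open>m\<close> is an ideal, so it contains \<open>Idl Y\<close>
  once it contains \<open>Y\<close>.\<close>

lemma (in module) zero_colon_genideal:
  assumes Y: "Y \<subseteq> carrier R"
  shows "zero_colon M (Idl Y) = {m \<in> carrier M. \<forall>a \<in> Y. a \<odot>\<^bsub>M\<^esub> m = \<zero>\<^bsub>M\<^esub>}"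
proof
  show "zero_colon M (Idl Y) \<subseteq> {m \<in> carrier M. \<forall>a \<in> Y. a \<odot>\<^bsub>M\<^esub> m = \<zero>\<^bsub>M\<^esub>}"
    using R.genideal_self[OF Y] by (auto simp: zero_colon_def)
next
  show "{m \<in> carrier M. \<forall>a \<in> Y. a \<odot>\<^bsub>M\<^esub> m = \<zero>\<^bsub>M\<^esub>} \<subseteq> zero_colon M (Idl Y)"
  proof
    fix m assume m: "m \<in> {m \<in> carrier M. \<forall>a \<in> Y. a \<odot>\<^bsub>M\<^esub> m = \<zero>\<^bsub>M\<^esub>}"
    then have "Idl Y \<subseteq> {a \<in> carrier R. a \<odot>\<^bsub>M\<^esub> m = \<zero>\<^bsub>M\<^esub>}"
      using Y by (intro R.genideal_minimal annihilator_ideal) auto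
    then show "m \<in> zero_colon M (Idl Y)"
      using m by (auto simp: zero_colon_def)
  qed
qed

section \<open>The Koszul complex on families of coefficients\<close>

lemma koszul_index_subset: "S \<in> koszul_index r p \<Longrightarrow> S \<subseteq> {..<r}"
  by (simp add: koszul_index_def)

lemma koszul_index_card: "S \<in> koszul_index r p \<Longrightarrow> card S = p"
  by (simp add: koszul_index_def)

lemma koszul_index_finite: "S \<in> koszul_index r p \<Longrightarrow> finite S"
  by (auto simp: koszul_index_def intro: finite_subset)

lemma koszul_index_0 [simp]: "koszul_index r 0 = {{}}"
  by (auto simp: koszul_index_def dest: finite_subset)

lemma koszul_index_1: "S \<in> koszul_index r (Suc 0) \<longleftrightarrow> (\<exists>j<r. S = {j})"
  by (auto simp: koszul_index_def card_1_singleton_iff)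

lemma koszul_index_remove:
  "S \<in> koszul_index r (Suc p) \<Longrightarrow> j \<in> S \<Longrightarrow> S - {j} \<in> koszul_index r p"
  by (auto simp: koszul_index_def)

lemma koszul_index_insert:
  assumes "T \<in> koszul_index r p"
  shows "insert r T \<in> koszul_index (Suc r) (Suc p)"
proof -
  have "r \<notin> T" "finite T"
    using assms by (auto simp: koszul_index_def intro: finite_subset)
  then show ?thesis
    using assms by (auto simp: koszul_index_def)
qed

lemma koszul_index_mono: "S \<in> koszul_index r p \<Longrightarrow> S \<in> koszul_index (Suc r) p"
  by (auto simp: koszul_index_def)

text \<open>The two cases are the two summands of the mapping cone; \<open>T\<close> has one element
  less than \<open>S\<close>, which is the degree shift of the second summand.\<close>

lemma koszul_index_Suc_cases:
  assumes "S \<in> koszul_index (Suc r) (Suc p)"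
  obtains "S \<in> koszul_index r (Suc p)" | T where "T \<in> koszul_index r p" "S = insert r T"
proof (cases "r \<in> S")
  case True
  then have "S - {r} \<in> koszul_index r p" "S = insert r (S - {r})"
    using assms by (auto simp: koszul_index_def less_Suc_eq)
  with that show ?thesis by blast
next
  case False
  then have "S \<in> koszul_index r (Suc p)"
    using assms by (auto simp: koszul_index_def less_Suc_eq)
  with that show ?thesis by blast
qed

lemma finite_koszul_index [simp]: "finite (koszul_index r p)"
  by (simp add: koszul_index_def)

lemma koszul_chains_simps [simp]:
  "carrier (koszul_chains A r p) = koszul_index r p \<rightarrow>\<^sub>E carrier A"
  "c \<oplus>\<^bsub>koszul_chains A r p\<^esub> d = (\<lambda>S \<in> koszul_index r p. c S \<oplus>\<^bsub>A\<^esub> d S)"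
  "a \<odot>\<^bsub>koszul_chains A r p\<^esub> c = (\<lambda>S \<in> koszul_index r p. a \<otimes>\<^bsub>A\<^esub> c S)"
  by (simp_all add: koszul_chains_def)

lemma koszul_cochains_zero [simp]:
  "\<zero>\<^bsub>koszul_cochains A r M p\<^esub> = (\<lambda>c \<in> koszul_index r p \<rightarrow>\<^sub>E carrier A. \<zero>\<^bsub>M\<^esub>)"
  by (simp add: koszul_cochains_def hom_module_def)

text \<open>The sequence is an infinite family, so that the length \<open>r\<close> can vary in
  inductions while \<open>x\<close> stays fixed.\<close>

locale koszul_sequence = module R M for R (structure) and M (structure) +
  fixes x :: "nat \<Rightarrow> 'a"
  assumes x_closed [simp]: "x j \<in> carrier R"
begin

abbreviation sgn_pow :: "nat \<Rightarrow> 'a" where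
  "sgn_pow n \<equiv> (\<ominus> \<one>) [^] n"

abbreviation (input) cochain :: "(nat set \<Rightarrow> 'c) \<Rightarrow> bool" where
  "cochain g \<equiv> \<forall>S. g S \<in> carrier M"

text \<open>
  Cochains of all degrees and lengths are functions on all index sets: the formula for the
  differential does not involve \<open>r\<close>, and only the values on \<open>koszul_index r p\<close> matter in degree \<open>p\<close>.
\<close>
definition \<delta> :: "(nat set \<Rightarrow> 'c) \<Rightarrow> nat set \<Rightarrow> 'c" where
  "\<delta> g S = (\<Oplus>\<^bsub>M\<^esub> j \<in> S. (sgn_pow (card {i \<in> S. i < j}) \<otimes> x j) \<odot>\<^bsub>M\<^esub> g (S - {j}))"

text \<open>Beware of the shift: this is exactness in degree \<open>p + 1\<close>.\<close>
definition exact_at :: "nat \<Rightarrow> nat \<Rightarrow> bool" where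
  "exact_at r p \<longleftrightarrow>
     (\<forall>g. cochain g \<longrightarrow> (\<forall>S \<in> koszul_index r (Suc (Suc p)). \<delta> g S = \<zero>\<^bsub>M\<^esub>) \<longrightarrow>
        (\<exists>h. cochain h \<and> (\<forall>S \<in> koszul_index r (Suc p). \<delta> h S = g S)))"

definition annihilated :: "nat \<Rightarrow> 'c set" where
  "annihilated r = {m \<in> carrier M. \<forall>j < r. x j \<odot>\<^bsub>M\<^esub> m = \<zero>\<^bsub>M\<^esub>}"

section \<open>Linearity of the differential\<close>

lemma annihilated_smult:
  assumes m: "m \<in> annihilated i" and a: "a \<in> carrier R"
  shows "a \<odot>\<^bsub>M\<^esub> m \<in> annihilated i"
proof -
  have "x j \<odot>\<^bsub>M\<^esub> (a \<odot>\<^bsub>M\<^esub> m) = a \<odot>\<^bsub>M\<^esub> (x j \<odot>\<^bsub>M\<^esub> m)" for j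
    using m a by (simp add: annihilated_def smult_assoc1[symmetric] R.m_comm)
  then show ?thesis
    using m a by (simp add: annihilated_def)
qed

lemma sgn_pow_mult_closed [simp]: "sgn_pow n \<otimes> x j \<in> carrier R"
  by simp

lemma \<delta>_cong:
  assumes "\<And>j. j \<in> S \<Longrightarrow> g (S - {j}) = h (S - {j})" "cochain h"
  shows "\<delta> g S = \<delta> h S"
  unfolding \<delta>_def using assms by (intro M.finsum_cong') auto

lemma \<delta>_closed [simp]: "cochain g \<Longrightarrow> \<delta> g S \<in> carrier M"
  unfolding \<delta>_def by (intro M.finsum_closed) auto

lemma \<delta>_add:
  assumes "cochain g" "cochain h"
  shows "\<delta> (\<lambda>S. g S \<oplus>\<^bsub>M\<^esub> h S) S = \<delta> g S \<oplus>\<^bsub>M\<^esub> \<delta> h S"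
  unfolding \<delta>_def using assms
  by (subst M.finsum_addf[symmetric]) (auto simp: smult_r_distr intro!: M.finsum_cong')

lemma \<delta>_smult:
  assumes "finite S" "cochain g" "a \<in> carrier R"
  shows "\<delta> (\<lambda>S. a \<odot>\<^bsub>M\<^esub> g S) S = a \<odot>\<^bsub>M\<^esub> \<delta> g S"
proof -
  have "b \<odot>\<^bsub>M\<^esub> (a \<odot>\<^bsub>M\<^esub> m) = a \<odot>\<^bsub>M\<^esub> (b \<odot>\<^bsub>M\<^esub> m)" if "b \<in> carrier R" "m \<in> carrier M" for b m
    using that assms by (metis R.m_comm smult_assoc1)
  then show ?thesis
    unfolding \<delta>_def using assms by (simp add: finsum_smult_ldistr Pi_def)
qed

lemma \<delta>_zero [simp]: "\<delta> (\<lambda>S. \<zero>\<^bsub>M\<^esub>) S = \<zero>\<^bsub>M\<^esub>"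
  unfolding \<delta>_def by (simp add: M.finsum_zero)

section \<open>Values of the differential and splitting off the last element\<close>

lemma \<delta>_singleton:
  assumes "cochain g"
  shows "\<delta> g {j} = x j \<odot>\<^bsub>M\<^esub> g {}"
proof -
  have empty: "{i. i = j \<and> i < j} = {}"
    by auto
  show ?thesis
    unfolding \<delta>_def using assms by (simp add: M.finsum_insert empty)
qed

text \<open>As \<open>r\<close> exceeds all of \<open>T\<close>, its own summand carries the
  exponent \<open>card T\<close>, and its presence does not change the exponent of any
  \<open>j \<in> T\<close>.\<close>

lemma \<delta>_insert:
  assumes T: "T \<subseteq> {..<r}" and g: "cochain g"
  shows "\<delta> g (insert r T)
    = (sgn_pow (card T) \<otimes> x r) \<odot>\<^bsub>M\<^esub> g T \<oplus>\<^bsub>M\<^esub> \<delta> (\<lambda>U. g (insert r U)) T"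
proof -
  have fin: "finite T"
    using T finite_subset by blast
  have r: "r \<notin> T" "{i \<in> insert r T. i < r} = T" "insert r T - {r} = T"
    using T by auto
  have j: "{i \<in> insert r T. i < j} = {i \<in> T. i < j}" "insert r T - {j} = insert r (T - {j})"
    if "j \<in> T" for j
    using that T r(1) by auto
  show ?thesis
    unfolding \<delta>_def
    by (subst M.finsum_insert) (use fin r j g in \<open>auto intro!: arg_cong2[where f = "(\<oplus>\<^bsub>M\<^esub>)"] M.finsum_cong'\<close>)
qed

text \<open>This cancellation of signs in adjacent degrees lies behind both
  \<open>\<delta>_\<delta>\<close> and the cocycle computations in the cone.\<close>

lemma sgn_pow_Suc_cancel:
  assumes "m \<in> carrier M"
  shows "(sgn_pow (Suc n) \<otimes> x r) \<odot>\<^bsub>M\<^esub> m \<oplus>\<^bsub>M\<^esub> (sgn_pow n \<otimes> x r) \<odot>\<^bsub>M\<^esub> m = \<zero>\<^bsub>M\<^esub>"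
proof -
  have "sgn_pow (Suc n) \<otimes> x r \<oplus> sgn_pow n \<otimes> x r = \<zero>"
    by (simp add: R.r_minus R.l_minus R.l_neg)
  then show ?thesis
    using assms by (metis sgn_pow_mult_closed smult_l_distr smult_l_null)
qed

text \<open>The pair of \<open>h\<^sub>0\<close> and \<open>h\<^sub>1\<close> in \<open>K(x\<^sub>0, \<dots>, x\<^sub>r) = K(x\<^sub>0, \<dots>, x\<^bsub>r-1\<^esub>) \<oplus> K(x\<^sub>0, \<dots>, x\<^bsub>r-1\<^esub>)[-1]\<close>.\<close>
definition koszul_cone :: "nat \<Rightarrow> (nat set \<Rightarrow> 'c) \<Rightarrow> (nat set \<Rightarrow> 'c) \<Rightarrow> nat set \<Rightarrow> 'c" where
  "koszul_cone r h0 h1 S = (if r \<in> S then h1 (S - {r}) else h0 S)"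

lemma koszul_cone_closed [simp]: "cochain h0 \<Longrightarrow> cochain h1 \<Longrightarrow> koszul_cone r h0 h1 S \<in> carrier M"
  by (simp add: koszul_cone_def)

lemma koszul_cone_insert: "r \<notin> T \<Longrightarrow> koszul_cone r h0 h1 (insert r T) = h1 T"
  by (simp add: koszul_cone_def)

lemma \<delta>_koszul_cone:
  assumes "S \<subseteq> {..<r}" "cochain h0"
  shows "\<delta> (koszul_cone r h0 h1) S = \<delta> h0 S"
  using assms by (intro \<delta>_cong) (auto simp: koszul_cone_def)

text \<open>The differential of a mapping cone: \<open>x r\<close>, up to sign, is the map
  connecting the two summands.\<close>

lemma \<delta>_koszul_cone_insert:
  assumes T: "T \<subseteq> {..<r}" and h: "cochain h0" "cochain h1"
  shows "\<delta> (koszul_cone r h0 h1) (insert r T) = (sgn_pow (card T) \<otimes> x r) \<odot>\<^bsub>M\<^esub> h0 T \<oplus>\<^bsub>M\<^esub> \<delta> h1 T"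
proof -
  have "r \<notin> T - {j}" for j
    using T by auto
  then have "\<delta> (\<lambda>U. koszul_cone r h0 h1 (insert r U)) T = \<delta> h1 T"
    using h by (intro \<delta>_cong) (simp_all add: koszul_cone_insert)
  moreover have "koszul_cone r h0 h1 T = h0 T"
    using T by (auto simp: koszul_cone_def)
  ultimately show ?thesis
    using \<delta>_insert[OF T, of "koszul_cone r h0 h1"] h by simp
qed

text \<open>Induction on \<open>r\<close>, splitting \<open>r\<close> off from \<open>S\<close>.
  With \<open>n = card T\<close>, two terms \<open>x r \<odot> \<delta> g T\<close> appear with
  exponents \<open>n\<close> and \<open>n - 1\<close> and cancel; the remaining term is
  \<open>\<delta> (\<delta> g1) T\<close>, zero by induction.\<close>

lemma \<delta>_\<delta>:
  assumes "cochain g" "S \<subseteq> {..<r}"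
  shows "\<delta> (\<delta> g) S = \<zero>\<^bsub>M\<^esub>"
  using assms
proof (induction r arbitrary: g S)
  case 0
  then show ?case by (simp add: \<delta>_def)
next
  case (Suc r)
  show ?case
  proof (cases "r \<in> S")
    case False
    then have "S \<subseteq> {..<r}"
      using Suc.prems by (auto simp: less_Suc_eq)
    then show ?thesis
      using Suc by blast
  next
    case True
    define T where "T = S - {r}"
    have T: "T \<subseteq> {..<r}" "S = insert r T"
      using Suc.prems True by (auto simp: T_def less_Suc_eq)
    have fin: "finite T"
      using T finite_subset by blast
    define g1 where "g1 = (\<lambda>U. g (insert r U))"
    have g: "cochain g" "cochain g1"
      using Suc.prems by (auto simp: g1_def)
    define n where "n = card T"
    \<comment> \<open>Only the faces \<open>T - {j}\<close> enter the outer differential, and they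
      have \<open>n - 1\<close> elements; this fixes the exponent.\<close>
    have "\<delta> (\<lambda>U. \<delta> g (insert r U)) T
      = \<delta> (\<lambda>U. (sgn_pow (n - 1) \<otimes> x r) \<odot>\<^bsub>M\<^esub> g U \<oplus>\<^bsub>M\<^esub> \<delta> g1 U) T"
    proof (rule \<delta>_cong)
      fix j assume "j \<in> T"
      then have "T - {j} \<subseteq> {..<r}" "card (T - {j}) = n - 1"
        using T fin by (auto simp: n_def)
      then show "\<delta> g (insert r (T - {j}))
        = (sgn_pow (n - 1) \<otimes> x r) \<odot>\<^bsub>M\<^esub> g (T - {j}) \<oplus>\<^bsub>M\<^esub> \<delta> g1 (T - {j})"
        using \<delta>_insert[of "T - {j}" r g] g by (simp add: g1_def)
    qed (use g in auto)
    also have "\<dots> = (sgn_pow (n - 1) \<otimes> x r) \<odot>\<^bsub>M\<^esub> \<delta> g T \<oplus>\<^bsub>M\<^esub> \<delta> (\<delta> g1) T"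
      using g fin by (simp add: \<delta>_add \<delta>_smult)
    also have "\<dots> = (sgn_pow (n - 1) \<otimes> x r) \<odot>\<^bsub>M\<^esub> \<delta> g T"
      using Suc.IH[of g1 T] g T by simp
    finally have *: "\<delta> (\<delta> g) S
      = (sgn_pow n \<otimes> x r) \<odot>\<^bsub>M\<^esub> \<delta> g T \<oplus>\<^bsub>M\<^esub> (sgn_pow (n - 1) \<otimes> x r) \<odot>\<^bsub>M\<^esub> \<delta> g T"
      using \<delta>_insert[OF T(1), of "\<delta> g"] g by (simp add: T(2) n_def)
    \<comment> \<open>For \<open>n = 0\<close> the truncated \<open>n - 1\<close> is 0 and the signs
      agree instead of cancelling, but then \<open>T\<close> is empty and
      \<open>\<delta> g T\<close> is an empty sum.\<close>
    show ?thesis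
    proof (cases n)
      case 0
      then have "T = {}"
        using fin by (simp add: n_def)
      then have "\<delta> g T = \<zero>\<^bsub>M\<^esub>"
        by (simp add: \<delta>_def)
      then show ?thesis
        using * by simp
    next
      case (Suc k)
      then show ?thesis
        using * sgn_pow_Suc_cancel[of "\<delta> g T" k r] g by simp
    qed
  qed
qed

section \<open>Exactness when the sequence grows or shrinks by one element\<close>

text \<open>A cocycle of the cone is a pair of \<open>g\<close> on sets without \<open>r\<close> and
  \<open>g1\<close>. The first component is bounded by some \<open>h0\<close>; the error
  \<open>k\<close> that \<open>h0\<close> leaves in the second component is a cocycle one degree
  lower. It is bounded by exactness in positive degree, and in degree 0 it is divided by
  \<open>x r\<close>.\<close>

lemma exact_at_Suc:
  assumes ex: "\<And>p. exact_at r p"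
    and surj: "annihilated r \<subseteq> (\<lambda>m. x r \<odot>\<^bsub>M\<^esub> m) ` annihilated r"
  shows "exact_at (Suc r) p"
  unfolding exact_at_def
proof (intro allI impI)
  fix g
  assume g: "cochain g" and cocycle: "\<forall>S \<in> koszul_index (Suc r) (Suc (Suc p)). \<delta> g S = \<zero>\<^bsub>M\<^esub>"
  define g1 where "g1 = (\<lambda>U. g (insert r U))"
  have g1: "cochain g1"
    using g by (simp add: g1_def)
  obtain h0 where h0: "cochain h0" "\<And>S. S \<in> koszul_index r (Suc p) \<Longrightarrow> \<delta> h0 S = g S"
    using ex[of p] g cocycle koszul_index_mono unfolding exact_at_def by metis
  \<comment> \<open>For the cone of \<open>h0\<close> and \<open>h1\<close> to bound
    \<open>g\<close>, the second component requires \<open>\<delta> h1 = g1 - (-1)^p x r h0\<close>,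
    and \<open>k\<close> is this right-hand side.\<close>
  define k where "k = (\<lambda>U. g1 U \<oplus>\<^bsub>M\<^esub> (sgn_pow (Suc p) \<otimes> x r) \<odot>\<^bsub>M\<^esub> h0 U)"
  have k: "cochain k"
    using g1 h0 by (simp add: k_def)
  have k_cocycle: "\<delta> k T = \<zero>\<^bsub>M\<^esub>" if T: "T \<in> koszul_index r (Suc p)" for T
  proof -
    have "\<delta> k T = \<delta> g1 T \<oplus>\<^bsub>M\<^esub> (sgn_pow (Suc p) \<otimes> x r) \<odot>\<^bsub>M\<^esub> g T"
      unfolding k_def using g1 h0 T koszul_index_finite[OF T]
      by (simp add: \<delta>_add \<delta>_smult del: R.nat_pow_Suc)
    also have "\<dots> = \<delta> g (insert r T)"
      using \<delta>_insert[OF koszul_index_subset[OF T] g] g g1 koszul_index_card[OF T]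
      by (simp add: g1_def M.a_comm del: R.nat_pow_Suc)
    also have "\<dots> = \<zero>\<^bsub>M\<^esub>"
      using cocycle koszul_index_insert[OF T] by blast
    finally show ?thesis .
  qed
  have k_eq: "(sgn_pow p \<otimes> x r) \<odot>\<^bsub>M\<^esub> h0 T \<oplus>\<^bsub>M\<^esub> k T = g1 T" for T
  proof -
    have "(sgn_pow p \<otimes> x r) \<odot>\<^bsub>M\<^esub> h0 T \<oplus>\<^bsub>M\<^esub> k T
      = g1 T \<oplus>\<^bsub>M\<^esub> ((sgn_pow (Suc p) \<otimes> x r) \<odot>\<^bsub>M\<^esub> h0 T \<oplus>\<^bsub>M\<^esub> (sgn_pow p \<otimes> x r) \<odot>\<^bsub>M\<^esub> h0 T)"
      unfolding k_def using h0(1) g1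
      by (simp add: M.a_ac del: R.nat_pow_Suc)
    then show ?thesis
      using sgn_pow_Suc_cancel h0(1) g1 by simp
  qed
  show "\<exists>h. cochain h \<and> (\<forall>S \<in> koszul_index (Suc r) (Suc p). \<delta> h S = g S)"
  proof (cases p)
    case (Suc q)
    \<comment> \<open>Because of the shift in \<open>exact_at\<close>, the instance \<open>q\<close>
      is exactness in degree \<open>q + 1 = p\<close>, the degree of \<open>k\<close>.\<close>
    obtain h1 where h1: "cochain h1" "\<And>S. S \<in> koszul_index r p \<Longrightarrow> \<delta> h1 S = k S"
      using ex[of q] k k_cocycle unfolding exact_at_def Suc by metis
    have "\<delta> (koszul_cone r h0 h1) S = g S" if "S \<in> koszul_index (Suc r) (Suc p)" for S
      using that
    proof (cases rule: koszul_index_Suc_cases)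
      case 1
      then show ?thesis
        using h0 \<delta>_koszul_cone koszul_index_subset by metis
    next
      case (2 T)
      then show ?thesis
        using \<delta>_koszul_cone_insert[OF koszul_index_subset[OF 2(1)] h0(1) h1(1)] h1(2) k_eq koszul_index_card
        by (simp add: g1_def)
    qed
    then show ?thesis
      using h0(1) h1(1) by (intro exI[of _ "koszul_cone r h0 h1"]) simp
  next
    case 0
    \<comment> \<open>In degree 0 a cocycle is an element killed by all earlier \<open>x j\<close>,
      so surjectivity of \<open>x r\<close> replaces exactness.\<close>
    have "k {} \<in> annihilated r"
    proof -
      have "x j \<odot>\<^bsub>M\<^esub> k {} = \<zero>\<^bsub>M\<^esub>" if "j < r" for j
        using k_cocycle[of "{j}"] that \<delta>_singleton[OF k] 0 by (simp add: koszul_index_1)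
      then show ?thesis
        using k by (simp add: annihilated_def)
    qed
    then obtain z where z: "z \<in> annihilated r" "x r \<odot>\<^bsub>M\<^esub> z = k {}"
      using surj by force
    \<comment> \<open>A degree-0 cochain matters only at \<open>{}\<close>, so a constant function
      suffices. Adding \<open>z\<close> changes nothing at \<open>j < r\<close> and supplies the
      missing \<open>k {}\<close> at \<open>r\<close>.\<close>
    define h where "h = (\<lambda>U :: nat set. h0 {} \<oplus>\<^bsub>M\<^esub> z)"
    have zM: "z \<in> carrier M"
      using z by (simp add: annihilated_def)
    have h: "cochain h"
      using h0 zM by (simp add: h_def)
    have "\<delta> h {j} = g {j}" if "j < Suc r" for j
    proof (cases "j = r")
      case True
      have "\<delta> h {r} = x r \<odot>\<^bsub>M\<^esub> h0 {} \<oplus>\<^bsub>M\<^esub> k {}"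
        using \<delta>_singleton[OF h] h0(1) zM z(2) by (simp add: h_def smult_r_distr)
      also have "\<dots> = g1 {}"
        using k_eq[of "{}"] 0 by simp
      finally show ?thesis
        by (simp add: True g1_def)
    next
      case False
      then have "j < r"
        using that by simp
      then have "x j \<odot>\<^bsub>M\<^esub> z = \<zero>\<^bsub>M\<^esub>"
        using z by (simp add: annihilated_def)
      then have "\<delta> h {j} = \<delta> h0 {j}"
        using \<delta>_singleton[OF h] \<delta>_singleton[OF h0(1)] h0(1) zM by (simp add: h_def smult_r_distr)
      then show ?thesis
        using h0(2)[of "{j}"] \<open>j < r\<close> 0 by (simp add: koszul_index_1)
    qed
    then have "\<forall>S \<in> koszul_index (Suc r) (Suc p). \<delta> h S = g S"
      using 0 by (auto simp: koszul_index_1)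
    then show ?thesis
      using h by blast
  qed
qed

text \<open>Exactness of the cone makes \<open>x r\<close> injective on the positive cohomology of
  the shorter complex. A power of \<open>x r\<close> kills a given cocycle \<open>g\<close>, so that
  multiple is a coboundary; the exponent is then lowered one by one to 0.\<close>

lemma exact_at_SucD:
  assumes ex: "\<And>p. exact_at (Suc r) p"
    and tors: "\<And>m. m \<in> carrier M \<Longrightarrow> \<exists>n::nat. (x r [^] n) \<odot>\<^bsub>M\<^esub> m = \<zero>\<^bsub>M\<^esub>"
  shows "exact_at r p"
  unfolding exact_at_def
proof (intro allI impI)
  fix g
  assume g: "cochain g" and cocycle: "\<forall>S \<in> koszul_index r (Suc (Suc p)). \<delta> g S = \<zero>\<^bsub>M\<^esub>"
  define bounds where
    "bounds n \<longleftrightarrow> (\<exists>h. cochain h \<and> (\<forall>S \<in> koszul_index r (Suc p). \<delta> h S = (x r [^] n) \<odot>\<^bsub>M\<^esub> g S))"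
    for n :: nat
  \<comment> \<open>If \<open>w = x\<^sub>r\<^sup>n g\<close> and \<open>x\<^sub>r w = \<delta> u\<close>, then \<open>(w, \<plusminus>u)\<close> is a cocycle of the cone, and a cochain that it
    bounds has a first component bounding \<open>w\<close>.\<close>
  have descend: "bounds n" if "bounds (Suc n)" for n
  proof -
    obtain u where u: "cochain u"
      "\<And>S. S \<in> koszul_index r (Suc p) \<Longrightarrow> \<delta> u S = (x r [^] Suc n) \<odot>\<^bsub>M\<^esub> g S"
      using \<open>bounds (Suc n)\<close> unfolding bounds_def by blast
    define w where "w = (\<lambda>S. (x r [^] n) \<odot>\<^bsub>M\<^esub> g S)"
    \<comment> \<open>The sign makes \<open>\<delta> v T\<close> the negative of the term with
      exponent \<open>p + 1\<close> that \<open>w\<close> contributes in the cone.\<close>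
    define v where "v = (\<lambda>S. sgn_pow p \<odot>\<^bsub>M\<^esub> u S)"
    have w: "cochain w" and v: "cochain v"
      using g u by (simp_all add: w_def v_def)
    have "\<delta> (koszul_cone r w v) S = \<zero>\<^bsub>M\<^esub>" if "S \<in> koszul_index (Suc r) (Suc (Suc p))" for S
      using that
    proof (cases rule: koszul_index_Suc_cases)
      case 1
      then have "\<delta> (koszul_cone r w v) S = (x r [^] n) \<odot>\<^bsub>M\<^esub> \<delta> g S"
        using \<delta>_koszul_cone[OF koszul_index_subset[OF 1] w, of v] \<delta>_smult[OF koszul_index_finite[OF 1] g]
        by (simp add: w_def)
      then show ?thesis
        using cocycle 1 by simp
    next
      case (2 T)
      have T: "T \<subseteq> {..<r}" "card T = Suc p" "finite T"
        using 2(1) koszul_index_subset koszul_index_card koszul_index_finite by blast+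
      have "\<delta> v T = sgn_pow p \<odot>\<^bsub>M\<^esub> ((x r [^] Suc n) \<odot>\<^bsub>M\<^esub> g T)"
        unfolding v_def using \<delta>_smult[OF T(3) u(1)] u(2)[OF 2(1)] by simp
      also have "\<dots> = (sgn_pow p \<otimes> x r) \<odot>\<^bsub>M\<^esub> w T"
        using g by (simp add: w_def smult_assoc1[symmetric] R.m_ac)
      finally show ?thesis
        using \<delta>_koszul_cone_insert[OF T(1) w v] 2 T(2) sgn_pow_Suc_cancel[of "w T" p r] w by simp
    qed
    then obtain h where h: "cochain h"
      "\<And>S. S \<in> koszul_index (Suc r) (Suc p) \<Longrightarrow> \<delta> h S = koszul_cone r w v S"
      using ex[of p] w v unfolding exact_at_def by (metis koszul_cone_closed)
    have "\<delta> h S = (x r [^] n) \<odot>\<^bsub>M\<^esub> g S" if S: "S \<in> koszul_index r (Suc p)" for S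
      using h(2)[OF koszul_index_mono[OF S]] koszul_index_subset[OF S] by (auto simp: koszul_cone_def w_def)
    then show ?thesis
      using h(1) unfolding bounds_def by blast
  qed
  have fin: "finite (koszul_index r (Suc p))"
    by (simp add: koszul_index_def)
  have "\<forall>S. \<exists>n::nat. (x r [^] n) \<odot>\<^bsub>M\<^esub> g S = \<zero>\<^bsub>M\<^esub>"
    using tors g by blast
  from choice[OF this] obtain n where n: "\<And>S. (x r [^] (n S :: nat)) \<odot>\<^bsub>M\<^esub> g S = \<zero>\<^bsub>M\<^esub>"
    by blast
  \<comment> \<open>A common exponent for all of the finitely many coefficients: the sum dominates
    each \<open>n S\<close>.\<close>
  define N where "N = (\<Sum>S \<in> koszul_index r (Suc p). n S)"
  have "(x r [^] N) \<odot>\<^bsub>M\<^esub> g S = \<zero>\<^bsub>M\<^esub>" if "S \<in> koszul_index r (Suc p)" for S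
  proof -
    have "n S \<le> N"
      unfolding N_def using fin that by (simp add: member_le_sum)
    then have "x r [^] N = x r [^] (N - n S) \<otimes> x r [^] n S"
      by (simp add: R.nat_pow_mult)
    then show ?thesis
      using n g by (simp add: smult_assoc1)
  qed
  then have "bounds N"
    unfolding bounds_def by (intro exI[of _ "\<lambda>S. \<zero>\<^bsub>M\<^esub>"]) simp
  then have "bounds 0"
    by (induction N) (use descend in auto)
  then show "\<exists>h. cochain h \<and> (\<forall>S \<in> koszul_index r (Suc p). \<delta> h S = g S)"
    using g by (simp add: bounds_def)
qed

text \<open>For \<open>z\<close> killed by the earlier elements, the pair \<open>(0, z)\<close> is a
  cocycle of degree 1. The element \<open>h {}\<close> bounding it is killed by every
  \<open>x j\<close> with \<open>j < r\<close> and is sent to \<open>z\<close> by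
  \<open>x r\<close>.\<close>

lemma exact_at_SucD_surj:
  assumes ex: "exact_at (Suc r) 0"
  shows "annihilated r \<subseteq> (\<lambda>m. x r \<odot>\<^bsub>M\<^esub> m) ` annihilated r"
proof
  fix z assume z: "z \<in> annihilated r"
  define g where "g = koszul_cone r (\<lambda>_. \<zero>\<^bsub>M\<^esub>) (\<lambda>_. z)"
  have zM: "z \<in> carrier M"
    using z by (simp add: annihilated_def)
  have g: "cochain g"
    using zM by (simp add: g_def)
  have "\<delta> g S = \<zero>\<^bsub>M\<^esub>" if "S \<in> koszul_index (Suc r) (Suc (Suc 0))" for S
    using that
  proof (cases rule: koszul_index_Suc_cases)
    case 1
    then show ?thesis
      using \<delta>_koszul_cone[OF koszul_index_subset[OF 1], of "\<lambda>_. \<zero>\<^bsub>M\<^esub>"] by (simp add: g_def)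
  next
    case (2 T)
    then obtain j where j: "j < r" "T = {j}"
      by (auto simp: koszul_index_1)
    have "\<delta> (\<lambda>_. z) {j} = \<zero>\<^bsub>M\<^esub>"
      using \<delta>_singleton[of "\<lambda>_. z" j] z j zM by (simp add: annihilated_def)
    then show ?thesis
      using \<delta>_koszul_cone_insert[of T r "\<lambda>_. \<zero>\<^bsub>M\<^esub>" "\<lambda>_. z"] j zM 2(2) by (simp add: g_def)
  qed
  then obtain h where h: "cochain h" "\<And>S. S \<in> koszul_index (Suc r) (Suc 0) \<Longrightarrow> \<delta> h S = g S"
    using ex g unfolding exact_at_def by metis
  have hj: "x j \<odot>\<^bsub>M\<^esub> h {} = g {j}" if "j < Suc r" for j
    using h(2)[of "{j}"] that \<delta>_singleton[OF h(1)] by (simp add: koszul_index_1)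
  have "h {} \<in> annihilated r"
    using hj h(1) by (simp add: annihilated_def g_def koszul_cone_def)
  moreover have "x r \<odot>\<^bsub>M\<^esub> h {} = z"
    using hj[of r] by (simp add: g_def koszul_cone_def)
  ultimately show "z \<in> (\<lambda>m. x r \<odot>\<^bsub>M\<^esub> m) ` annihilated r"
    by blast
qed

text \<open>The empty sequence has no index sets in positive degree.\<close>

lemma exact_at_0: "exact_at 0 p"
  by (auto simp: exact_at_def koszul_index_def)

text \<open>Each induction step trades exactness for \<open>r + 1\<close> against exactness for
  \<open>r\<close> together with surjectivity of \<open>x r\<close> on \<open>annihilated r\<close>.
  Torsion is what allows the passage down from \<open>r + 1\<close> to \<open>r\<close>.\<close>

proposition exact_iff_surj:
  assumes "\<And>j m. j < r \<Longrightarrow> m \<in> carrier M \<Longrightarrow> \<exists>n::nat. (x j [^] n) \<odot>\<^bsub>M\<^esub> m = \<zero>\<^bsub>M\<^esub>"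
  shows "(\<forall>p. exact_at r p) \<longleftrightarrow>
    (\<forall>i < r. annihilated i \<subseteq> (\<lambda>m. x i \<odot>\<^bsub>M\<^esub> m) ` annihilated i)"
  using assms
proof (induction r)
  case 0
  then show ?case by (simp add: exact_at_0)
next
  case (Suc r)
  have "(\<forall>p. exact_at (Suc r) p) \<longleftrightarrow>
    (\<forall>p. exact_at r p) \<and> annihilated r \<subseteq> (\<lambda>m. x r \<odot>\<^bsub>M\<^esub> m) ` annihilated r"
    using exact_at_Suc exact_at_SucD exact_at_SucD_surj Suc.prems by blast
  then show ?case
    using Suc by (auto simp: less_Suc_eq)
qed

subsection \<open>Comparison with homomorphisms out of the Koszul chains\<close>

abbreviation chain_space :: "nat \<Rightarrow> nat \<Rightarrow> (nat set \<Rightarrow> 'a) set" where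
  "chain_space r p \<equiv> koszul_index r p \<rightarrow>\<^sub>E carrier R"

abbreviation cochain_space :: "nat \<Rightarrow> nat \<Rightarrow> ((nat set \<Rightarrow> 'a) \<Rightarrow> 'c) set" where
  "cochain_space r p \<equiv> carrier (koszul_cochains R r M p)"

lemma cochainsI:
  assumes "f \<in> extensional (chain_space r p)"
    and "\<And>c. c \<in> chain_space r p \<Longrightarrow> f c \<in> carrier M"
    and "\<And>c d. c \<in> chain_space r p \<Longrightarrow> d \<in> chain_space r p \<Longrightarrow>
      f (\<lambda>S \<in> koszul_index r p. c S \<oplus> d S) = f c \<oplus>\<^bsub>M\<^esub> f d"
    and "\<And>a c. a \<in> carrier R \<Longrightarrow> c \<in> chain_space r p \<Longrightarrow>
      f (\<lambda>S \<in> koszul_index r p. a \<otimes> c S) = a \<odot>\<^bsub>M\<^esub> f c"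
  shows "f \<in> cochain_space r p"
  using assms by (auto simp: koszul_cochains_def hom_module_def PiE_def)

lemma cochainsD:
  assumes "f \<in> cochain_space r p"
  shows "f \<in> extensional (chain_space r p)"
    and "c \<in> chain_space r p \<Longrightarrow> f c \<in> carrier M"
    and "c \<in> chain_space r p \<Longrightarrow> d \<in> chain_space r p \<Longrightarrow>
      f (\<lambda>S \<in> koszul_index r p. c S \<oplus> d S) = f c \<oplus>\<^bsub>M\<^esub> f d"
    and "a \<in> carrier R \<Longrightarrow> c \<in> chain_space r p \<Longrightarrow>
      f (\<lambda>S \<in> koszul_index r p. a \<otimes> c S) = a \<odot>\<^bsub>M\<^esub> f c"
  using assms by (auto simp: koszul_cochains_def hom_module_def PiE_def)

lemma chains_add:
  "c \<in> chain_space r p \<Longrightarrow> d \<in> chain_space r p \<Longrightarrow>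
    (\<lambda>S \<in> koszul_index r p. c S \<oplus> d S) \<in> chain_space r p"
  by auto

lemma chains_smult:
  "a \<in> carrier R \<Longrightarrow> c \<in> chain_space r p \<Longrightarrow>
    (\<lambda>S \<in> koszul_index r p. a \<otimes> c S) \<in> chain_space r p"
  by auto

section \<open>Homomorphisms and their values on basis vectors\<close>

definition basis :: "nat \<Rightarrow> nat \<Rightarrow> nat set \<Rightarrow> nat set \<Rightarrow> 'a" where
  "basis r p S = (\<lambda>T \<in> koszul_index r p. if T = S then \<one> else \<zero>)"

lemma basis_closed [simp]: "basis r p S \<in> chain_space r p"
  by (auto simp: basis_def)

lemma cochain_expansion:
  assumes f: "f \<in> cochain_space r p" and c: "c \<in> chain_space r p"
  shows "f c = (\<Oplus>\<^bsub>M\<^esub> S \<in> koszul_index r p. c S \<odot>\<^bsub>M\<^esub> f (basis r p S))"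
proof -
  have c_mem: "c S \<in> carrier R" if "S \<in> koszul_index r p" for S
    using c that by auto
  \<comment> \<open>Truncating \<open>c\<close> to \<open>F\<close> allows induction on
    \<open>F\<close>, one coordinate at a time; the full index set gives back
    \<open>c\<close>.\<close>
  have "f (\<lambda>S \<in> koszul_index r p. if S \<in> F then c S else \<zero>)
      = (\<Oplus>\<^bsub>M\<^esub> S \<in> F. c S \<odot>\<^bsub>M\<^esub> f (basis r p S))"
    if "finite F" "F \<subseteq> koszul_index r p" for F
    using that
  proof (induction F)
    case empty
    \<comment> \<open>The zero chain is written as \<open>\<zero>\<close> times \<open>c\<close>, so
      that homogeneity of \<open>f\<close> gives its value.\<close>
    have "f (\<lambda>S \<in> koszul_index r p. \<zero> \<otimes> c S) = \<zero>\<^bsub>M\<^esub>"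
      using cochainsD(2,4)[OF f] c by simp
    moreover have "(\<lambda>S \<in> koszul_index r p. \<zero> \<otimes> c S) = (\<lambda>S \<in> koszul_index r p. \<zero>)"
      using c_mem by (intro restrict_ext) simp
    ultimately show ?case by (simp add: restrict_def)
  next
    case (insert S F)
    let ?d = "\<lambda>T \<in> koszul_index r p. c S \<otimes> basis r p S T"
    let ?e = "\<lambda>T \<in> koszul_index r p. if T \<in> F then c T else \<zero>"
    have d: "?d \<in> chain_space r p" and e: "?e \<in> chain_space r p"
      using insert.prems c_mem by (auto simp: basis_def)
    have "(\<lambda>T \<in> koszul_index r p. if T \<in> insert S F then c T else \<zero>)
        = (\<lambda>T \<in> koszul_index r p. ?d T \<oplus> ?e T)"
      using insert.hyps insert.prems c_mem by (intro restrict_ext) (auto simp: basis_def)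
    then have "f (\<lambda>T \<in> koszul_index r p. if T \<in> insert S F then c T else \<zero>) = f ?d \<oplus>\<^bsub>M\<^esub> f ?e"
      using cochainsD(3)[OF f d e] by simp
    also have "f ?d = c S \<odot>\<^bsub>M\<^esub> f (basis r p S)"
      using cochainsD(4)[OF f] c_mem insert.prems by simp
    also have "f ?e = (\<Oplus>\<^bsub>M\<^esub> S \<in> F. c S \<odot>\<^bsub>M\<^esub> f (basis r p S))"
      using insert.IH insert.prems by (simp only: insert_subset)
    also have "c S \<odot>\<^bsub>M\<^esub> f (basis r p S) \<oplus>\<^bsub>M\<^esub> (\<Oplus>\<^bsub>M\<^esub> S \<in> F. c S \<odot>\<^bsub>M\<^esub> f (basis r p S))
        = (\<Oplus>\<^bsub>M\<^esub> S \<in> insert S F. c S \<odot>\<^bsub>M\<^esub> f (basis r p S))"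
      using insert.hyps insert.prems c_mem cochainsD(2)[OF f basis_closed]
      by (subst M.finsum_insert) auto
    finally show ?case .
  qed
  from this[of "koszul_index r p"]
  have "f (\<lambda>S \<in> koszul_index r p. c S) = (\<Oplus>\<^bsub>M\<^esub> S \<in> koszul_index r p. c S \<odot>\<^bsub>M\<^esub> f (basis r p S))"
    by (simp cong: restrict_cong)
  moreover have "(\<lambda>S \<in> koszul_index r p. c S) = c"
    using c by (auto simp: PiE_restrict)
  ultimately show ?thesis by simp
qed

lemma cochains_eqI:
  assumes f: "f \<in> cochain_space r p" and g: "g \<in> cochain_space r p"
    and eq: "\<And>S. S \<in> koszul_index r p \<Longrightarrow> f (basis r p S) = g (basis r p S)"
  shows "f = g"
proof (rule extensionalityI)
  fix c assume c: "c \<in> chain_space r p"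
  show "f c = g c"
    unfolding cochain_expansion[OF f c] cochain_expansion[OF g c]
    using c eq cochainsD(2)[OF g] by (intro M.finsum_cong') auto
qed (use cochainsD(1) f g in auto)

definition hom_of :: "nat \<Rightarrow> nat \<Rightarrow> (nat set \<Rightarrow> 'c) \<Rightarrow> (nat set \<Rightarrow> 'a) \<Rightarrow> 'c" where
  "hom_of r p g = (\<lambda>c \<in> chain_space r p. \<Oplus>\<^bsub>M\<^esub> S \<in> koszul_index r p. c S \<odot>\<^bsub>M\<^esub> g S)"

lemma hom_of_closed:
  assumes g: "cochain g"
  shows "hom_of r p g \<in> cochain_space r p"
proof (rule cochainsI)
  fix c assume c: "c \<in> chain_space r p"
  then have mem: "c S \<in> carrier R" if "S \<in> koszul_index r p" for S
    using that by auto
  show "hom_of r p g c \<in> carrier M"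
    using c g by (auto simp: hom_of_def intro!: M.finsum_closed)
  show "hom_of r p g (\<lambda>S \<in> koszul_index r p. a \<otimes> c S) = a \<odot>\<^bsub>M\<^esub> hom_of r p g c"
    if a: "a \<in> carrier R" for a
  proof -
    have "(\<Oplus>\<^bsub>M\<^esub> S \<in> koszul_index r p. (a \<otimes> c S) \<odot>\<^bsub>M\<^esub> g S)
      = (\<Oplus>\<^bsub>M\<^esub> S \<in> koszul_index r p. a \<odot>\<^bsub>M\<^esub> (c S \<odot>\<^bsub>M\<^esub> g S))"
      using a g mem by (intro M.finsum_cong') (auto simp: smult_assoc1)
    also have "\<dots> = a \<odot>\<^bsub>M\<^esub> (\<Oplus>\<^bsub>M\<^esub> S \<in> koszul_index r p. c S \<odot>\<^bsub>M\<^esub> g S)"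
      using a g mem by (subst finsum_smult_ldistr) auto
    moreover have "(\<Oplus>\<^bsub>M\<^esub> S \<in> koszul_index r p. (\<lambda>S \<in> koszul_index r p. a \<otimes> c S) S \<odot>\<^bsub>M\<^esub> g S)
      = (\<Oplus>\<^bsub>M\<^esub> S \<in> koszul_index r p. (a \<otimes> c S) \<odot>\<^bsub>M\<^esub> g S)"
      using a g mem by (intro M.finsum_cong') auto
    ultimately show ?thesis
      using chains_smult[OF a c] c by (simp add: hom_of_def)
  qed
  show "hom_of r p g (\<lambda>S \<in> koszul_index r p. c S \<oplus> d S) = hom_of r p g c \<oplus>\<^bsub>M\<^esub> hom_of r p g d"
    if d: "d \<in> chain_space r p" for d
  proof -
    have mem': "d S \<in> carrier R" if "S \<in> koszul_index r p" for S
      using that d by auto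
    have "(\<Oplus>\<^bsub>M\<^esub> S \<in> koszul_index r p. (\<lambda>S \<in> koszul_index r p. c S \<oplus> d S) S \<odot>\<^bsub>M\<^esub> g S)
      = (\<Oplus>\<^bsub>M\<^esub> S \<in> koszul_index r p. c S \<odot>\<^bsub>M\<^esub> g S \<oplus>\<^bsub>M\<^esub> d S \<odot>\<^bsub>M\<^esub> g S)"
      using g mem mem' by (intro M.finsum_cong') (auto simp: smult_l_distr)
    also have "\<dots> = (\<Oplus>\<^bsub>M\<^esub> S \<in> koszul_index r p. c S \<odot>\<^bsub>M\<^esub> g S)
      \<oplus>\<^bsub>M\<^esub> (\<Oplus>\<^bsub>M\<^esub> S \<in> koszul_index r p. d S \<odot>\<^bsub>M\<^esub> g S)"
      using g mem mem' by (subst M.finsum_addf) auto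
    finally show ?thesis
      using chains_add[OF c d] c d by (simp add: hom_of_def)
  qed
qed (simp add: hom_of_def)

lemma hom_of_basis:
  assumes g: "cochain g" and S: "S \<in> koszul_index r p"
  shows "hom_of r p g (basis r p S) = g S"
proof -
  have "(\<Oplus>\<^bsub>M\<^esub> T \<in> koszul_index r p. basis r p S T \<odot>\<^bsub>M\<^esub> g T)
    = (\<Oplus>\<^bsub>M\<^esub> T \<in> koszul_index r p. if S = T then g T else \<zero>\<^bsub>M\<^esub>)"
    using g by (intro M.finsum_cong') (auto simp: basis_def)
  also have "\<dots> = g S"
    using g S by (intro M.finsum_singleton) auto
  finally show ?thesis
    by (simp add: hom_of_def)
qed

text \<open>The default zero off degree \<open>p\<close> makes this a total family, as
  \<open>\<delta>\<close> expects. In degree \<open>p\<close> it inverts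
  \<open>hom_of\<close>.\<close>

definition coeffs :: "nat \<Rightarrow> nat \<Rightarrow> ((nat set \<Rightarrow> 'a) \<Rightarrow> 'c) \<Rightarrow> nat set \<Rightarrow> 'c" where
  "coeffs r p f S = (if S \<in> koszul_index r p then f (basis r p S) else \<zero>\<^bsub>M\<^esub>)"

lemma coeffs_closed: "f \<in> cochain_space r p \<Longrightarrow> cochain (coeffs r p f)"
  using cochainsD(2) by (simp add: coeffs_def)

lemma \<delta>_cong_index:
  assumes "\<And>T. T \<in> koszul_index r p \<Longrightarrow> g T = h T" "cochain h" "S \<in> koszul_index r (Suc p)"
  shows "\<delta> g S = \<delta> h S"
  using assms by (intro \<delta>_cong) (auto intro: koszul_index_remove)

section \<open>Linear operations on cochains\<close>

lemma cochains_add: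
  assumes f: "f \<in> cochain_space r p" and g: "g \<in> cochain_space r p"
  shows "(\<lambda>c \<in> chain_space r p. f c \<oplus>\<^bsub>M\<^esub> g c) \<in> cochain_space r p"
proof (rule cochainsI)
  fix c assume c: "c \<in> chain_space r p"
  note mem = cochainsD(2)[OF f] cochainsD(2)[OF g]
  show "(\<lambda>c \<in> chain_space r p. f c \<oplus>\<^bsub>M\<^esub> g c) c \<in> carrier M"
    using c mem by simp
  show "(\<lambda>c \<in> chain_space r p. f c \<oplus>\<^bsub>M\<^esub> g c) (\<lambda>S \<in> koszul_index r p. a \<otimes> c S)
    = a \<odot>\<^bsub>M\<^esub> (\<lambda>c \<in> chain_space r p. f c \<oplus>\<^bsub>M\<^esub> g c) c" if a: "a \<in> carrier R" for a
    using a c mem chains_smult[OF a c] cochainsD(4)[OF f a c] cochainsD(4)[OF g a c]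
    by (simp add: smult_r_distr)
  show "(\<lambda>c \<in> chain_space r p. f c \<oplus>\<^bsub>M\<^esub> g c) (\<lambda>S \<in> koszul_index r p. c S \<oplus> d S)
    = (\<lambda>c \<in> chain_space r p. f c \<oplus>\<^bsub>M\<^esub> g c) c \<oplus>\<^bsub>M\<^esub> (\<lambda>c \<in> chain_space r p. f c \<oplus>\<^bsub>M\<^esub> g c) d"
    if d: "d \<in> chain_space r p" for d
    using d c mem chains_add[OF c d] cochainsD(3)[OF f c d] cochainsD(3)[OF g c d]
    by (simp add: M.a_ac)
qed simp

lemma cochains_smult:
  assumes f: "f \<in> cochain_space r p" and b: "b \<in> carrier R"
  shows "(\<lambda>c \<in> chain_space r p. b \<odot>\<^bsub>M\<^esub> f c) \<in> cochain_space r p"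
proof (rule cochainsI)
  fix c assume c: "c \<in> chain_space r p"
  note mem = cochainsD(2)[OF f]
  show "(\<lambda>c \<in> chain_space r p. b \<odot>\<^bsub>M\<^esub> f c) c \<in> carrier M"
    using c mem b by simp
  show "(\<lambda>c \<in> chain_space r p. b \<odot>\<^bsub>M\<^esub> f c) (\<lambda>S \<in> koszul_index r p. a \<otimes> c S)
    = a \<odot>\<^bsub>M\<^esub> (\<lambda>c \<in> chain_space r p. b \<odot>\<^bsub>M\<^esub> f c) c" if a: "a \<in> carrier R" for a
    using a b c mem chains_smult[OF a c] cochainsD(4)[OF f a c]
    by (simp add: smult_assoc1[symmetric] R.m_comm)
  show "(\<lambda>c \<in> chain_space r p. b \<odot>\<^bsub>M\<^esub> f c) (\<lambda>S \<in> koszul_index r p. c S \<oplus> d S)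
    = (\<lambda>c \<in> chain_space r p. b \<odot>\<^bsub>M\<^esub> f c) c \<oplus>\<^bsub>M\<^esub> (\<lambda>c \<in> chain_space r p. b \<odot>\<^bsub>M\<^esub> f c) d"
    if d: "d \<in> chain_space r p" for d
    using d c b mem chains_add[OF c d] cochainsD(3)[OF f c d]
    by (simp add: smult_r_distr)
qed simp

lemma cochains_zero: "(\<lambda>c \<in> chain_space r p. \<zero>\<^bsub>M\<^esub>) \<in> cochain_space r p"
  by (rule cochainsI) (auto intro: PiE_mem)

section \<open>Coregularity in terms of annihilators\<close>

context
  fixes xs :: "'a list"
  assumes nth_xs: "\<And>j. j < length xs \<Longrightarrow> xs ! j = x j"
begin

lemma zero_colon_take:
  assumes i: "i \<le> length xs"
  shows "zero_colon M (Idl (set (take i xs))) = annihilated i"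
proof -
  have "set (take i xs) = (!) xs ` {..<i}"
    using nth_image[OF i] by (simp add: atLeast0LessThan)
  also have "\<dots> = x ` {..<i}"
    using i nth_xs by (intro image_cong) auto
  finally show ?thesis
    by (auto simp: zero_colon_genideal image_subset_iff annihilated_def)
qed

text \<open>Multiplication by \<open>x i\<close> always maps \<open>annihilated i\<close> into
  itself, so equality is surjectivity; \<open>carrier M = annihilated 0\<close> turns the first
  condition into the case \<open>i = 0\<close>.\<close>

lemma coregular_iff:
  assumes "xs \<noteq> []"
  shows "coregular R M xs \<longleftrightarrow>
    (\<forall>i < length xs. annihilated i \<subseteq> (\<lambda>m. x i \<odot>\<^bsub>M\<^esub> m) ` annihilated i)"
proof -
  have eq_iff: "(\<lambda>m. x i \<odot>\<^bsub>M\<^esub> m) ` annihilated i = annihilated i \<longleftrightarrow>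
      annihilated i \<subseteq> (\<lambda>m. x i \<odot>\<^bsub>M\<^esub> m) ` annihilated i" for i
    using annihilated_smult[of _ i "x i"] by auto
  have zero: "carrier M = annihilated 0"
    by (simp add: annihilated_def)
  have "coregular R M xs \<longleftrightarrow>
      (\<lambda>m. x 0 \<odot>\<^bsub>M\<^esub> m) ` annihilated 0 = annihilated 0 \<and>
      (\<forall>i. 1 \<le> i \<and> i < length xs \<longrightarrow> (\<lambda>m. x i \<odot>\<^bsub>M\<^esub> m) ` annihilated i = annihilated i)"
  proof -
    \<comment> \<open>The truncated subtraction is harmless because \<open>xs\<close> is
      non-empty.\<close>
    have "i \<le> length xs - 1 \<longleftrightarrow> i < length xs" for i
      using assms by (cases xs) auto
    then show ?thesis
      using assms unfolding coregular_def by (simp add: zero zero_colon_take nth_xs cong: conj_cong imp_cong)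
  qed
  also have "\<dots> \<longleftrightarrow> (\<forall>i < length xs. (\<lambda>m. x i \<odot>\<^bsub>M\<^esub> m) ` annihilated i = annihilated i)"
    using assms by (metis One_nat_def Suc_leI length_greater_0_conv neq0_conv)
  finally show ?thesis
    by (simp only: eq_iff)
qed

section \<open>The Koszul differential and its dual\<close>

lemma koszul_diff_eq:
  assumes "T \<in> koszul_index (length xs) p" "c \<in> chain_space (length xs) (Suc p)"
  shows "koszul_diff R xs p c T
    = (\<Oplus> j \<in> {..<length xs} - T. sgn_pow (card {i \<in> T. i < j}) \<otimes> x j \<otimes> c (insert j T))"
    and "\<And>j. j \<in> {..<length xs} - T \<Longrightarrow> c (insert j T) \<in> carrier R"
proof -
  show mem: "c (insert j T) \<in> carrier R" if "j \<in> {..<length xs} - T" for j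
  proof -
    have "insert j T \<in> koszul_index (length xs) (Suc p)"
      using that assms(1) koszul_index_finite[OF assms(1)] by (auto simp: koszul_index_def)
    then show ?thesis
      using assms(2) by auto
  qed
  show "koszul_diff R xs p c T
    = (\<Oplus> j \<in> {..<length xs} - T. sgn_pow (card {i \<in> T. i < j}) \<otimes> x j \<otimes> c (insert j T))"
    using assms(1) mem by (auto simp: koszul_diff_def nth_xs intro!: R.finsum_cong')
qed

lemma koszul_diff_closed:
  assumes c: "c \<in> chain_space (length xs) (Suc p)"
  shows "koszul_diff R xs p c \<in> chain_space (length xs) p"
proof
  fix T assume T: "T \<in> koszul_index (length xs) p"
  show "koszul_diff R xs p c T \<in> carrier R"
    unfolding koszul_diff_eq(1)[OF T c]
    using koszul_diff_eq(2)[OF T c] by (intro R.finsum_closed) auto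
qed (simp add: koszul_diff_def)

lemma koszul_diff_add:
  assumes c: "c \<in> chain_space (length xs) (Suc p)" and d: "d \<in> chain_space (length xs) (Suc p)"
  shows "koszul_diff R xs p (\<lambda>S \<in> koszul_index (length xs) (Suc p). c S \<oplus> d S)
    = (\<lambda>T \<in> koszul_index (length xs) p. koszul_diff R xs p c T \<oplus> koszul_diff R xs p d T)"
    (is "koszul_diff R xs p ?s = ?rhs")
proof (rule extensionalityI)
  fix T assume T: "T \<in> koszul_index (length xs) p"
  note mem = koszul_diff_eq(2)[OF T]
  have s: "?s \<in> chain_space (length xs) (Suc p)"
    by (rule chains_add[OF c d])
  have s_eq: "?s (insert j T) = c (insert j T) \<oplus> d (insert j T)" if "j \<in> {..<length xs} - T" for j
    using that T koszul_index_finite[OF T] by (auto simp: koszul_index_def)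
  have "koszul_diff R xs p ?s T = (\<Oplus> j \<in> {..<length xs} - T.
      sgn_pow (card {i \<in> T. i < j}) \<otimes> x j \<otimes> c (insert j T) \<oplus>
      sgn_pow (card {i \<in> T. i < j}) \<otimes> x j \<otimes> d (insert j T))"
    unfolding koszul_diff_eq(1)[OF T s]
    using mem[OF c] mem[OF d] by (intro R.finsum_cong') (auto simp: s_eq R.r_distr simp del: restrict_apply)
  also have "\<dots> = koszul_diff R xs p c T \<oplus> koszul_diff R xs p d T"
    unfolding koszul_diff_eq(1)[OF T c] koszul_diff_eq(1)[OF T d]
    using mem[OF c] mem[OF d] by (intro R.finsum_addf) auto
  finally show "koszul_diff R xs p ?s T = ?rhs T"
    using T by simp
qed (auto simp: koszul_diff_def)

lemma koszul_diff_smult: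
  assumes a: "a \<in> carrier R" and c: "c \<in> chain_space (length xs) (Suc p)"
  shows "koszul_diff R xs p (\<lambda>S \<in> koszul_index (length xs) (Suc p). a \<otimes> c S)
    = (\<lambda>T \<in> koszul_index (length xs) p. a \<otimes> koszul_diff R xs p c T)"
    (is "koszul_diff R xs p ?s = ?rhs")
proof (rule extensionalityI)
  fix T assume T: "T \<in> koszul_index (length xs) p"
  note mem = koszul_diff_eq(2)[OF T]
  have s: "?s \<in> chain_space (length xs) (Suc p)"
    by (rule chains_smult[OF a c])
  have s_eq: "?s (insert j T) = a \<otimes> c (insert j T)" if "j \<in> {..<length xs} - T" for j
    using that T koszul_index_finite[OF T] by (auto simp: koszul_index_def)
  have "koszul_diff R xs p ?s T = (\<Oplus> j \<in> {..<length xs} - T.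
      a \<otimes> (sgn_pow (card {i \<in> T. i < j}) \<otimes> x j \<otimes> c (insert j T)))"
    unfolding koszul_diff_eq(1)[OF T s]
    using mem[OF c] a by (intro R.finsum_cong') (auto simp: s_eq R.m_lcomm simp del: restrict_apply)
  also have "\<dots> = a \<otimes> koszul_diff R xs p c T"
    unfolding koszul_diff_eq(1)[OF T c]
    using mem[OF c] a by (subst R.finsum_rdistr) auto
  finally show "koszul_diff R xs p ?s T = ?rhs T"
    using T by simp
qed (auto simp: koszul_diff_def)

lemma koszul_codiff_closed:
  assumes f: "f \<in> cochain_space (length xs) p"
  shows "koszul_codiff R xs p f \<in> cochain_space (length xs) (Suc p)"
proof (rule cochainsI)
  fix c assume c: "c \<in> chain_space (length xs) (Suc p)"
  show "koszul_codiff R xs p f c \<in> carrier M"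
    using c cochainsD(2)[OF f] koszul_diff_closed by (simp add: koszul_codiff_def)
  show "koszul_codiff R xs p f (\<lambda>S \<in> koszul_index (length xs) (Suc p). a \<otimes> c S)
    = a \<odot>\<^bsub>M\<^esub> koszul_codiff R xs p f c" if "a \<in> carrier R" for a
    using that c chains_smult[OF that c] cochainsD(4)[OF f that koszul_diff_closed[OF c]]
    by (simp add: koszul_codiff_def koszul_diff_smult)
  show "koszul_codiff R xs p f (\<lambda>S \<in> koszul_index (length xs) (Suc p). c S \<oplus> d S)
    = koszul_codiff R xs p f c \<oplus>\<^bsub>M\<^esub> koszul_codiff R xs p f d"
    if d: "d \<in> chain_space (length xs) (Suc p)" for d
    using d c chains_add[OF c d] cochainsD(3)[OF f koszul_diff_closed[OF c] koszul_diff_closed[OF d]]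
    by (simp add: koszul_codiff_def koszul_diff_add)
qed (simp add: koszul_codiff_def)

text \<open>Among the sets \<open>insert k (S - {j})\<close> only \<open>k = j\<close> gives back
  \<open>S\<close>, so a single summand survives.\<close>

lemma koszul_diff_basis_remove:
  assumes S: "S \<in> koszul_index (length xs) (Suc p)" and j: "j \<in> S"
  shows "koszul_diff R xs p (basis (length xs) (Suc p) S) (S - {j}) = sgn_pow (card {i \<in> S. i < j}) \<otimes> x j"
proof -
  have T: "S - {j} \<in> koszul_index (length xs) p"
    using koszul_index_remove[OF S j] .
  have j_mem: "j \<in> {..<length xs} - (S - {j})"
    using koszul_index_subset[OF S] j by auto
  have "basis (length xs) (Suc p) S (insert k (S - {j})) = (if j = k then \<one> else \<zero>)"
    if "k \<in> {..<length xs} - (S - {j})" for k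
  proof -
    have "insert k (S - {j}) \<in> koszul_index (length xs) (Suc p)"
      using that T koszul_index_finite[OF T] by (auto simp: koszul_index_def)
    moreover have "insert k (S - {j}) = S \<longleftrightarrow> j = k"
      using that j by auto
    ultimately show ?thesis
      by (simp add: basis_def)
  qed
  then have "koszul_diff R xs p (basis (length xs) (Suc p) S) (S - {j})
    = (\<Oplus> k \<in> {..<length xs} - (S - {j}).
        if j = k then sgn_pow (card {i \<in> S - {j}. i < k}) \<otimes> x k else \<zero>)"
    unfolding koszul_diff_eq(1)[OF T basis_closed] by (intro R.finsum_cong') auto
  also have "\<dots> = sgn_pow (card {i \<in> S - {j}. i < j}) \<otimes> x j"
    using j_mem by (intro R.finsum_singleton) auto
  also have "{i \<in> S - {j}. i < j} = {i \<in> S. i < j}"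
    by auto
  finally show ?thesis .
qed

lemma koszul_diff_basis_eq_zero:
  assumes S: "S \<in> koszul_index (length xs) (Suc p)" and T: "T \<in> koszul_index (length xs) p"
    and not_face: "T \<notin> (\<lambda>j. S - {j}) ` S"
  shows "koszul_diff R xs p (basis (length xs) (Suc p) S) T = \<zero>"
proof -
  have "basis (length xs) (Suc p) S (insert k T) = \<zero>" if k: "k \<in> {..<length xs} - T" for k
  proof -
    have "insert k T \<in> koszul_index (length xs) (Suc p)"
      using k T koszul_index_finite[OF T] by (auto simp: koszul_index_def)
    \<comment> \<open>Since \<open>k \<notin> T\<close>, equality would make \<open>T\<close> the
      face \<open>S - {k}\<close>.\<close>
    moreover have "insert k T \<noteq> S"
      using not_face k by auto
    ultimately show ?thesis
      by (simp add: basis_def)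
  qed
  then show ?thesis
    unfolding koszul_diff_eq(1)[OF T basis_closed] by (simp add: R.finsum_zero cong: R.finsum_cong)
qed

text \<open>This identifies the dual differential with \<open>\<delta>\<close>: expanding the
  boundary of the basis vector at \<open>S\<close>, only the faces \<open>S - {j}\<close>
  contribute, with the signs of \<open>\<delta>\<close>.\<close>

lemma koszul_codiff_basis:
  assumes f: "f \<in> cochain_space (length xs) p" and S: "S \<in> koszul_index (length xs) (Suc p)"
  shows "koszul_codiff R xs p f (basis (length xs) (Suc p) S) = \<delta> (coeffs (length xs) p f) S"
proof -
  let ?b = "basis (length xs) (Suc p) S" and ?face = "\<lambda>j. S - {j}"
  let ?t = "\<lambda>T. koszul_diff R xs p ?b T \<odot>\<^bsub>M\<^esub> f (basis (length xs) p T)"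
  note diff = koszul_diff_closed[OF basis_closed[of "length xs" "Suc p" S]]
  have faces: "?face ` S \<subseteq> koszul_index (length xs) p"
    using koszul_index_remove[OF S] by auto
  have t: "?t T \<in> carrier M" if "T \<in> koszul_index (length xs) p" for T
    using that diff cochainsD(2)[OF f basis_closed] by auto
  have "koszul_codiff R xs p f ?b = f (koszul_diff R xs p ?b)"
    by (simp add: koszul_codiff_def)
  also have "\<dots> = (\<Oplus>\<^bsub>M\<^esub> T \<in> koszul_index (length xs) p. ?t T)"
    by (rule cochain_expansion[OF f diff])
  also have "\<dots> = (\<Oplus>\<^bsub>M\<^esub> T \<in> ?face ` S. ?t T)"
    using faces t koszul_diff_basis_eq_zero[OF S] cochainsD(2)[OF f basis_closed]
    by (intro M.add.finprod_mono_neutral_cong_right) auto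
  \<comment> \<open>Distinct \<open>j \<in> S\<close> give distinct faces, so the sum can be indexed
    by \<open>j\<close>.\<close>
  also have "\<dots> = (\<Oplus>\<^bsub>M\<^esub> j \<in> S. ?t (?face j))"
    using faces t by (intro M.finsum_reindex) (auto simp: inj_on_def)
  also have "\<dots> = \<delta> (coeffs (length xs) p f) S"
    unfolding \<delta>_def using koszul_diff_basis_remove[OF S] koszul_index_remove[OF S]
      cochainsD(2)[OF f basis_closed]
    by (intro M.finsum_cong') (auto simp: coeffs_def)
  finally show ?thesis .
qed

section \<open>Cocycles and coboundaries\<close>

lemma koszul_cocycles_iff:
  "f \<in> koszul_cocycles R xs M p \<longleftrightarrow> f \<in> cochain_space (length xs) p \<and>
    (\<forall>c \<in> chain_space (length xs) (Suc p). f (koszul_diff R xs p c) = \<zero>\<^bsub>M\<^esub>)"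
  by (auto simp: koszul_cocycles_def koszul_codiff_def fun_eq_iff restrict_def)

text \<open>A homomorphism vanishes once it vanishes on the basis, where the dual differential takes
  the values of \<open>\<delta>\<close>.\<close>

lemma koszul_cocycles_iff_\<delta>:
  assumes f: "f \<in> cochain_space (length xs) p"
  shows "f \<in> koszul_cocycles R xs M p \<longleftrightarrow>
    (\<forall>S \<in> koszul_index (length xs) (Suc p). \<delta> (coeffs (length xs) p f) S = \<zero>\<^bsub>M\<^esub>)"
proof
  assume "f \<in> koszul_cocycles R xs M p"
  then show "\<forall>S \<in> koszul_index (length xs) (Suc p). \<delta> (coeffs (length xs) p f) S = \<zero>\<^bsub>M\<^esub>"
    using koszul_codiff_basis[OF f] by (auto simp: koszul_cocycles_def)
next
  assume "\<forall>S \<in> koszul_index (length xs) (Suc p). \<delta> (coeffs (length xs) p f) S = \<zero>\<^bsub>M\<^esub>"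
  then have "koszul_codiff R xs p f = (\<lambda>c \<in> chain_space (length xs) (Suc p). \<zero>\<^bsub>M\<^esub>)"
    using koszul_codiff_basis[OF f] by (intro cochains_eqI[OF koszul_codiff_closed[OF f] cochains_zero]) simp
  then show "f \<in> koszul_cocycles R xs M p"
    using f by (simp add: koszul_cocycles_def)
qed

lemma koszul_coboundaries_subset_cocycles:
  "koszul_coboundaries R xs M (Suc p) \<subseteq> koszul_cocycles R xs M (Suc p)"
proof
  fix f assume "f \<in> koszul_coboundaries R xs M (Suc p)"
  then obtain u where u: "u \<in> cochain_space (length xs) p" "f = koszul_codiff R xs p u"
    by (auto simp: koszul_coboundaries_def)
  have f: "f \<in> cochain_space (length xs) (Suc p)"
    using u koszul_codiff_closed by simp
  have "\<delta> (coeffs (length xs) (Suc p) f) S = \<zero>\<^bsub>M\<^esub>" if S: "S \<in> koszul_index (length xs) (Suc (Suc p))" for S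
  proof -
    have "coeffs (length xs) (Suc p) f T = \<delta> (coeffs (length xs) p u) T"
      if "T \<in> koszul_index (length xs) (Suc p)" for T
      using that by (simp add: coeffs_def[of _ "Suc p"] u(2) koszul_codiff_basis[OF u(1)])
    then have "\<delta> (coeffs (length xs) (Suc p) f) S = \<delta> (\<delta> (coeffs (length xs) p u)) S"
      using S coeffs_closed[OF u(1)] by (intro \<delta>_cong_index) simp_all
    then show ?thesis
      using \<delta>_\<delta> coeffs_closed[OF u(1)] koszul_index_subset[OF S] by simp
  qed
  then show "f \<in> koszul_cocycles R xs M (Suc p)"
    using koszul_cocycles_iff_\<delta>[OF f] by blast
qed

text \<open>Cocycles and their primitives are carried back and forth: \<open>hom_of\<close> turns
  families into homomorphisms, \<open>coeffs\<close> recovers families, and both respect the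
  differentials.\<close>

lemma koszul_cocycles_subset_coboundaries_iff:
  "koszul_cocycles R xs M (Suc p) \<subseteq> koszul_coboundaries R xs M (Suc p) \<longleftrightarrow> exact_at (length xs) p"
  (is "?Z \<subseteq> ?B \<longleftrightarrow> _")
proof
  assume sub: "?Z \<subseteq> ?B"
  show "exact_at (length xs) p"
    unfolding exact_at_def
  proof (intro allI impI)
    fix g
    assume g: "cochain g" and cocycle: "\<forall>S \<in> koszul_index (length xs) (Suc (Suc p)). \<delta> g S = \<zero>\<^bsub>M\<^esub>"
    let ?f = "hom_of (length xs) (Suc p) g"
    have f: "?f \<in> cochain_space (length xs) (Suc p)"
      using hom_of_closed[OF g] .
    have "\<delta> (coeffs (length xs) (Suc p) ?f) S = \<delta> g S" if "S \<in> koszul_index (length xs) (Suc (Suc p))" for S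
      using that g hom_of_basis[OF g] by (intro \<delta>_cong_index) (simp_all add: coeffs_def)
    then have "?f \<in> ?B"
      using cocycle koszul_cocycles_iff_\<delta>[OF f] sub by auto
    then obtain u where u: "u \<in> cochain_space (length xs) p" "?f = koszul_codiff R xs p u"
      by (auto simp: koszul_coboundaries_def)
    have "\<delta> (coeffs (length xs) p u) S = g S" if "S \<in> koszul_index (length xs) (Suc p)" for S
      using koszul_codiff_basis[OF u(1) that] hom_of_basis[OF g that] u(2) by simp
    then show "\<exists>h. cochain h \<and> (\<forall>S \<in> koszul_index (length xs) (Suc p). \<delta> h S = g S)"
      using coeffs_closed[OF u(1)] by blast
  qed
next
  assume ex: "exact_at (length xs) p"
  show "?Z \<subseteq> ?B"
  proof
    fix f assume f_cocycle: "f \<in> ?Z"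
    then have f: "f \<in> cochain_space (length xs) (Suc p)"
      by (simp add: koszul_cocycles_def)
    obtain h where h: "cochain h"
      "\<And>S. S \<in> koszul_index (length xs) (Suc p) \<Longrightarrow> \<delta> h S = coeffs (length xs) (Suc p) f S"
      using ex f_cocycle koszul_cocycles_iff_\<delta>[OF f] coeffs_closed[OF f] unfolding exact_at_def by metis
    let ?u = "hom_of (length xs) p h"
    have u: "?u \<in> cochain_space (length xs) p"
      using hom_of_closed[OF h(1)] .
    have "koszul_codiff R xs p ?u = f"
    proof (rule cochains_eqI[OF koszul_codiff_closed[OF u] f])
      fix S assume S: "S \<in> koszul_index (length xs) (Suc p)"
      have "koszul_codiff R xs p ?u (basis (length xs) (Suc p) S) = \<delta> (coeffs (length xs) p ?u) S"
        by (rule koszul_codiff_basis[OF u S])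
      also have "\<dots> = \<delta> h S"
        using S h(1) hom_of_basis[OF h(1)] by (intro \<delta>_cong_index) (simp_all add: coeffs_def)
      finally show "koszul_codiff R xs p ?u (basis (length xs) (Suc p) S) = f (basis (length xs) (Suc p) S)"
        using h(2)[OF S] S by (simp add: coeffs_def)
    qed
    then show "f \<in> ?B"
      using u by (auto simp: koszul_coboundaries_def)
  qed
qed

section \<open>The cohomology groups\<close>

lemma koszul_cocycles_group:
  "group (add_monoid (koszul_cochains R (length xs) M p \<lparr>carrier := koszul_cocycles R xs M p\<rparr>))"
    (is "group ?G")
proof (rule groupI)
  have carrier: "carrier ?G = koszul_cocycles R xs M p"
    and mult: "f \<otimes>\<^bsub>?G\<^esub> g = (\<lambda>c \<in> chain_space (length xs) p. f c \<oplus>\<^bsub>M\<^esub> g c)"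
    and one: "\<one>\<^bsub>?G\<^esub> = (\<lambda>c \<in> chain_space (length xs) p. \<zero>\<^bsub>M\<^esub>)" for f g
    by (simp_all add: koszul_cochains_def hom_module_def)
  note G = carrier mult one
  have mem: "f c \<in> carrier M" if "f \<in> carrier ?G" "c \<in> chain_space (length xs) p" for f c
    using that cochainsD(2)[of f "length xs" p c] by (simp add: carrier koszul_cocycles_iff)
  have ext: "f \<in> extensional (chain_space (length xs) p)" if "f \<in> carrier ?G" for f
    using that cochainsD(1) by (simp add: carrier koszul_cocycles_iff)
  show "f \<otimes>\<^bsub>?G\<^esub> g \<in> carrier ?G" if "f \<in> carrier ?G" "g \<in> carrier ?G" for f g
    using that cochains_add koszul_diff_closed
    unfolding G koszul_cocycles_iff by simp
  show "\<one>\<^bsub>?G\<^esub> \<in> carrier ?G"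
    using cochains_zero koszul_diff_closed unfolding G koszul_cocycles_iff by simp
  show "f \<otimes>\<^bsub>?G\<^esub> g \<otimes>\<^bsub>?G\<^esub> h = f \<otimes>\<^bsub>?G\<^esub> (g \<otimes>\<^bsub>?G\<^esub> h)"
    if "f \<in> carrier ?G" "g \<in> carrier ?G" "h \<in> carrier ?G" for f g h
    unfolding mult using mem that by (intro restrict_ext) (simp add: M.a_assoc)
  show "\<one>\<^bsub>?G\<^esub> \<otimes>\<^bsub>?G\<^esub> f = f" if "f \<in> carrier ?G" for f
    unfolding mult one
    by (rule extensionalityI[OF _ ext[OF that]]) (use mem that in auto)
  show "\<exists>g \<in> carrier ?G. g \<otimes>\<^bsub>?G\<^esub> f = \<one>\<^bsub>?G\<^esub>" if f: "f \<in> carrier ?G" for f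
  proof
    \<comment> \<open>Scaling by \<open>\<ominus> \<one>\<close> gives the additive inverse, so
      closure under scalars applies.\<close>
    let ?g = "\<lambda>c \<in> chain_space (length xs) p. (\<ominus> \<one>) \<odot>\<^bsub>M\<^esub> f c"
    show "?g \<in> carrier ?G"
      using f cochains_smult koszul_diff_closed unfolding G koszul_cocycles_iff by simp
    show "?g \<otimes>\<^bsub>?G\<^esub> f = \<one>\<^bsub>?G\<^esub>"
      unfolding mult one using mem[OF f]
      by (intro restrict_ext) (simp add: smult_l_minus M.l_neg)
  qed
qed

text \<open>The quotient is trivial when \<open>B\<close> is its only coset, that is, when every
  cocycle is a coboundary.\<close>

lemma trivial_koszul_cohomology_iff:
  "trivial_group (koszul_cohomology R xs M (Suc p)) \<longleftrightarrow> exact_at (length xs) p"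
proof -
  define Z where "Z = koszul_cocycles R xs M (Suc p)"
  define B where "B = koszul_coboundaries R xs M (Suc p)"
  define G where "G = add_monoid (koszul_cochains R (length xs) M (Suc p) \<lparr>carrier := Z\<rparr>)"
  have cohomology: "koszul_cohomology R xs M (Suc p) = G Mod B"
    by (simp add: koszul_cohomology_def G_def Z_def B_def)
  interpret G: group G
    unfolding G_def Z_def by (rule koszul_cocycles_group)
  have carrier_G: "carrier G = Z"
    by (simp add: G_def)
  have BZ: "B \<subseteq> Z"
    unfolding B_def Z_def by (rule koszul_coboundaries_subset_cocycles)
  have "trivial_group (G Mod B) \<longleftrightarrow> Z \<subseteq> B"
  proof
    assume "trivial_group (G Mod B)"
    then have cosets: "rcosets\<^bsub>G\<^esub> B = {B}"
      by (simp add: trivial_group_def FactGroup_def)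
    \<comment> \<open>The neutral element is the zero cochain, the image of the zero cochain one
      degree lower. It puts \<open>f\<close> into its own coset, and that coset is
      \<open>B\<close>.\<close>
    have "\<one>\<^bsub>G\<^esub> \<in> B"
    proof -
      let ?o = "\<lambda>c \<in> chain_space (length xs) p. \<zero>\<^bsub>M\<^esub>"
      have "koszul_codiff R xs p ?o = \<one>\<^bsub>G\<^esub>"
        using koszul_diff_closed
        by (auto simp: G_def koszul_codiff_def koszul_cochains_def hom_module_def intro!: restrict_ext)
      then show ?thesis
        using cochains_zero by (auto simp: B_def koszul_coboundaries_def intro!: image_eqI)
    qed
    show "Z \<subseteq> B"
    proof
      fix f assume f: "f \<in> Z"
      then have "B #>\<^bsub>G\<^esub> f = B"
        using cosets carrier_G by (auto simp: RCOSETS_def)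
      moreover have "\<one>\<^bsub>G\<^esub> \<otimes>\<^bsub>G\<^esub> f \<in> B #>\<^bsub>G\<^esub> f"
        using \<open>\<one>\<^bsub>G\<^esub> \<in> B\<close> by (auto simp: r_coset_def)
      ultimately show "f \<in> B"
        using f carrier_G by simp
    qed
  next
    assume "Z \<subseteq> B"
    then have B: "B = carrier G"
      using BZ carrier_G by blast
    \<comment> \<open>Here \<open>B\<close> is all of \<open>G\<close>: it is normal, and every
      translate of it is \<open>B\<close> again.\<close>
    have "group (G Mod B)"
      unfolding B using G.normal_self by (rule normal.factorgroup_is_group)
    moreover have "rcosets\<^bsub>G\<^esub> B = {B}"
      using G.coset_join2[OF _ G.subgroup_self] G.one_closed unfolding B RCOSETS_def by blast
    ultimately show "trivial_group (G Mod B)"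
      by (simp add: trivial_group_def FactGroup_def)
  qed
  then show ?thesis
    using koszul_cocycles_subset_coboundaries_iff by (simp add: cohomology Z_def B_def)
qed

end

end

theorem theorem2p6:
  fixes A :: "('a, 'c) ring_scheme"
    and M :: "('a, 'm, 'd) module_scheme"
    and I :: "'a set"
    and xs :: "'a list"
  assumes ring_cases:
      "(noetherian_local_ring A \<and> module A M) \<or>
       (\<exists>\<A> \<M>. standard_graded_ring A \<A> \<and> graded_module A \<A> M \<M> \<and>
          homogeneous_ideal A \<A> I \<and> set xs \<subseteq> homogeneous_elements \<A>)"
    and I: "ideal I A"
    and M_nonzero: "carrier M \<noteq> {\<zero>\<^bsub>M\<^esub>}"
    and supp: "Supp A M \<subseteq> zero_locus A I"
    and xs: "length xs \<ge> 1" "set xs \<subseteq> I"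
  shows "coregular A M xs \<longleftrightarrow> (\<forall>i \<ge> 1. trivial_group (koszul_cohomology A xs M i))"
proof -
  have "module A M"
    using ring_cases by (auto simp: graded_module_def)
  then interpret module A M .
  have carrier: "set xs \<subseteq> carrier A"
    using xs(2) ideal.Icarr[OF I] by blast
  \<comment> \<open>Padding with zero extends the list to a family lying in \<open>A\<close> at
    every index, as \<open>koszul_sequence\<close> requires.\<close>
  define x where "x = (\<lambda>j. if j < length xs then xs ! j else \<zero>\<^bsub>A\<^esub>)"
  interpret koszul_sequence A M x
    by unfold_locales (use carrier in \<open>auto simp: x_def\<close>)
  have nth_xs: "xs ! j = x j" if "j < length xs" for j
    using that by (simp add: x_def)
  have torsion: "\<exists>n::nat. (x j [^]\<^bsub>A\<^esub> n) \<odot>\<^bsub>M\<^esub> m = \<zero>\<^bsub>M\<^esub>" if "j < length xs" "m \<in> carrier M" for j m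
    using that xs(2) nth_xs power_torsion_of_Supp[OF supp _ x_closed] nth_mem by fastforce
  have "xs \<noteq> []"
    using xs(1) by auto
  then have "coregular A M xs \<longleftrightarrow> (\<forall>p. exact_at (length xs) p)"
    by (simp only: coregular_iff[OF nth_xs] exact_iff_surj[OF torsion] not_False_eq_True)
  also have "\<dots> \<longleftrightarrow> (\<forall>p. trivial_group (koszul_cohomology A xs M (Suc p)))"
    using trivial_koszul_cohomology_iff[OF nth_xs] by simp
  also have "\<dots> \<longleftrightarrow> (\<forall>i \<ge> 1. trivial_group (koszul_cohomology A xs M i))"
    by (metis One_nat_def Suc_le_D Suc_le_mono le0)
  finally show ?thesis .
qed

end
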